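(* Let $\Theta\in(0,\pi/2)$, $m,\widetilde m\in\mathbb{N}_0$, and $\widetilde\Theta=\left|\arg\left(s_m(e^{i\Theta};\Theta)\right)\right|$. Then $$s_{\widetilde m}\big(s_m(z;\Theta);\widetilde\Theta\big)=s_{\widetilde m m}(z;\Theta).$$
   Context: $\mathbb{N}_0=\{0,1,2,\dots\}$; $\arg$ is the principal argument. $\mathrm{sn}(\cdot,k),\mathrm{cn}(\cdot,k),\mathrm{dn}(\cdot,k)$ are Jacobi's elliptic functions with modulus $k$ (not parameter $k^2$), and $K(k)=\int_0^{\pi/2}(1-k^2\sin^2\theta)^{-1/2}\,d\theta$ is the complete elliptic integral of the first kind. For $m\in\mathbb{N}_0$ and $\Theta\in(0,\pi/2)$, with $\ell=\cos\Theta$ and $\ell'=\sqrt{1-\ell^2}$, define $$s_m(z;\Theta)=i^{1-m}\prod_{j=1}^m\frac{z-ib_j}{1+ib_jz},\qquad b_j=(-1)^{mj}\left(\frac{\ell\,\mathrm{sn}\left(\frac{2j-1}{m}K(\ell'),\ell'\right)+\mathrm{dn}\left(\frac{2j-1}{m}K(\ell'),\ell'\right)}{\mathrm{cn}\left(\frac{2j-1}{m}K(\ell'),\ell'\right)}\right)^{(-1)^j},$$ where the empty product is $1$, so $s_0(z;\Theta)=i$. When $m=2k+1$ is odd and $j=k+1$, $\mathrm{cn}\left(\frac{2j-1}{m}K(\ell'),\ell'\right)=0$, so $b_j=0$ if $k$ is even and $b_j=\infty$ if $k$ is odd; when $b_j=\infty$ the factor $\frac{z-ib_j}{1+ib_jz}$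 is understood as its limit $-1/z$. *)

theory Defs
  imports "HOL-Analysis.Analysis"
begin

section \<open>Jacobi's elliptic functions of a real argument and modulus \<open>0 \<le> k < 1\<close>\<close>

definition ellipticF :: "real \<Rightarrow> real \<Rightarrow> real" where
  "ellipticF k \<phi> = (LBINT \<theta>=0..ereal \<phi>. 1 / sqrt (1 - k\<^sup>2 * (sin \<theta>)\<^sup>2))"

definition ellipticK :: "real \<Rightarrow> real" where
  "ellipticK k = (LBINT \<theta>=0..ereal (pi / 2). 1 / sqrt (1 - k\<^sup>2 * (sin \<theta>)\<^sup>2))"

text \<open>
  For \<open>0 \<le> k < 1\<close> the incomplete integral is an increasing bijection of the real line in its
  upper limit; the Jacobi amplitude is its inverse.
\<close>

definition jacobi_am :: "real \<Rightarrow> real \<Rightarrow> real" where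
  "jacobi_am u k = (THE \<phi>. ellipticF k \<phi> = u)"

definition jacobi_sn :: "real \<Rightarrow> real \<Rightarrow> real" where
  "jacobi_sn u k = sin (jacobi_am u k)"

definition jacobi_cn :: "real \<Rightarrow> real \<Rightarrow> real" where
  "jacobi_cn u k = cos (jacobi_am u k)"

definition jacobi_dn :: "real \<Rightarrow> real \<Rightarrow> real" where
  "jacobi_dn u k = sqrt (1 - k\<^sup>2 * (jacobi_sn u k)\<^sup>2)"

section \<open>The coefficients and the defining formula\<close>

text \<open>
  The coefficients are extended reals. The only vanishing \<open>cn\<close> is the one with \<open>2 * j - 1 = m\<close>;
  there the numerator is positive, so the quotient is \<open>\<infinity>\<close> in \<^typ>\<open>ereal\<close>, its reciprocal is \<open>0\<close>,
  and since \<open>m\<close> is odd the sign is \<open>+1\<close> when \<open>j\<close> is even. So \<open>b\<close> is \<open>\<infinity>\<close> for even \<open>j\<close> and \<open>0\<close> for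
  odd \<open>j\<close>.
\<close>

definition zol_b :: "nat \<Rightarrow> real \<Rightarrow> nat \<Rightarrow> ereal" where
  "zol_b m \<Theta> j =
    (let l = cos \<Theta>;
         l' = sqrt (1 - l\<^sup>2);
         u = (2 * real j - 1) / real m * ellipticK l'
     in (-1) ^ (m * j) *
        (ereal (l * jacobi_sn u l' + jacobi_dn u l') / ereal (jacobi_cn u l')) powi ((-1) ^ j))"

definition zol_factor :: "ereal \<Rightarrow> complex \<Rightarrow> complex" where
  "zol_factor b z =
    (if \<bar>b\<bar> = \<infinity> then - 1 / z
     else (z - \<i> * of_real (real_of_ereal b)) / (1 + \<i> * of_real (real_of_ereal b) * z))"

text \<open>
  This is the value of the rational function at points where no denominator vanishes, in
  particular on the unit circle.
\<close>

definition zol_formula :: "nat \<Rightarrow> real \<Rightarrow> complex \<Rightarrow> complex" where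
  "zol_formula m \<Theta> z = \<i> powi (1 - int m) * (\<Prod>j=1..m. zol_factor (zol_b m \<Theta> j) z)"

section \<open>The rational function as a self-map of the Riemann sphere\<close>

text \<open>
  The Riemann sphere is the one-point compactification of the plane, \<^const>\<open>None\<close> being the point
  at infinity. A rational function given by a formula valid outside a finite set takes at every
  point of the sphere its limit there; this yields the values at the poles and at infinity.
\<close>

definition riemann_sphere :: "complex option topology" where
  "riemann_sphere = Alexandroff_compactification (euclidean :: complex topology)"

definition sphere_lim :: "'a filter \<Rightarrow> ('a \<Rightarrow> complex option) \<Rightarrow> complex option" where
  "sphere_lim F f = (THE w. limitin riemann_sphere f w F)"

definition sphere_ext :: "(complex \<Rightarrow> complex) \<Rightarrow> complex option \<Rightarrow> complex option" where
  "sphere_ext f w =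
    sphere_lim (case w of None \<Rightarrow> at_infinity | Some a \<Rightarrow> at a) (\<lambda>z. Some (f z))"

text \<open>
  The defining formula requires \<open>0 < \<Theta> < \<pi>/2\<close>. At \<open>\<Theta> = \<pi>/2\<close> the modulus is \<open>1\<close>, where \<open>K\<close> is
  infinite, and the value is read as the pointwise limit from the left. This boundary value of
  the parameter arises as \<open>\<bar>arg \<i>\<bar>\<close> from the constant function \<open>\<i>\<close> of index \<open>0\<close>.
\<close>

definition zol_s :: "nat \<Rightarrow> real \<Rightarrow> complex option \<Rightarrow> complex option" where
  "zol_s m \<Theta> w =
    (if \<Theta> = pi / 2 then sphere_lim (at_left (pi / 2)) (\<lambda>t. sphere_ext (zol_formula m t) w)
     else sphere_ext (zol_formula m \<Theta>) w)"

end

theory Submission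
  imports Defs "HOL-Complex_Analysis.Complex_Analysis"
begin

text \<open>
  Put \<open>k = sin \<Theta>\<close>. The arc \<open>\<bar>arg z\<bar> \<le> \<Theta>\<close> of the unit circle is traversed once, downwards, by
  \<open>z = cis (\<omega> v)\<close> with \<open>sin (\<omega> v) = k cn v / dn v\<close> and \<open>0 \<le> v \<le> 2 K\<close>. In this coordinate a linear
  fractional factor of \<open>s\<^sub>m\<close> becomes \<open>- \<i> exp (\<i> (A (v - a) - A (v + a)) / 2)\<close>, where
  \<open>A' = dn + k cn\<close>; this is the addition theorem in disguise (lemma \<open>factor_on_arc\<close>). The parameters
  \<open>a\<close> of \<open>s\<^sub>m\<close> together with their negatives are equally spaced over one period of \<open>A'\<close> and enter
  with alternating signs. Hence \<open>s\<^sub>m (cis (\<omega> v)) = cis (phase m v)\<close> for a real function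
  \<open>phase m\<close> that changes its sign when \<open>v\<close> is increased by \<open>2 K / m\<close> (\<open>phase_shift\<close>). A critical
  point of the phase would therefore produce \<open>m\<close> of them on the arc and, by the symmetry
  \<open>z \<mapsto> - cnj z\<close>, \<open>m\<close> more on the opposite arc, too many for the derivative of a function of
  degree \<open>m\<close>. So the phase is monotone between consecutive multiples of \<open>2 K / m\<close>: it oscillates \<open>m\<close>
  times between \<open>\<Theta>'\<close> and \<open>- \<Theta>'\<close>, where \<open>\<Theta>' = \<bar>phase m 0\<bar>\<close>.

  Consequently \<open>s\<^sub>m\<close> maps the arc for \<open>\<Theta>\<close> \<open>m\<close> times onto the arc for \<open>\<Theta>'\<close>, on which the outer function
  \<open>s\<^bsub>m'\<^esub>\<close> oscillates \<open>m'\<close> times. Thus the composite and \<open>s\<^bsub>m'm\<^esub>\<close> are two functions of degree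
  \<open>n = m' m\<close> that equioscillate \<open>n\<close> times on the same arc, with amplitudes that are not yet known to
  agree. Whichever has the larger amplitude crosses the other one \<open>n\<close> times there, with
  multiplicity (\<open>dominated_competitor\<close>, \<open>crossing_competitor\<close>). By symmetry there are \<open>n\<close> further
  coincidences on the opposite arc, and both functions fix \<open>\<i>\<close>. The difference of two functions
  of degree \<open>n\<close> has at most \<open>2 n\<close> zeros unless it vanishes identically, so the two agree
  (\<open>composite_identity\<close>).

  Finally, a nonconstant rational function maps punctured neighbourhoods into punctured
  neighbourhoods, so values defined as limits on the sphere compose (\<open>sphere_ext_compose\<close>). For
  \<open>m = 0\<close> the inner function is the constant \<open>\<i>\<close>, a fixed point of \<open>s\<^bsub>m'\<^esub>\<close> for every parameter
  (\<open>zol_at_i\<close>).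
\<close>

section \<open>Jacobi's functions of a real argument\<close>

locale elliptic_modulus =
  fixes k :: real
  assumes k_pos: "0 < k" and k_less_1: "k < 1"
begin

abbreviation K :: real where "K \<equiv> ellipticK k"
abbreviation am :: "real \<Rightarrow> real" where "am u \<equiv> jacobi_am u k"
abbreviation sn :: "real \<Rightarrow> real" where "sn u \<equiv> jacobi_sn u k"
abbreviation cn :: "real \<Rightarrow> real" where "cn u \<equiv> jacobi_cn u k"
abbreviation dn :: "real \<Rightarrow> real" where "dn u \<equiv> jacobi_dn u k"
text \<open>
  The complementary modulus, which is \<open>cos \<Theta>\<close> when \<open>k = sin \<Theta>\<close>.
\<close>

definition kc :: real where "kc = sqrt (1 - k\<^sup>2)"

lemma kc_pos: "0 < kc" and kc_sq: "kc\<^sup>2 = 1 - k\<^sup>2"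
proof -
  have "0 < k\<^sup>2" "k\<^sup>2 < 1" using k_pos k_less_1 by (auto simp: power_less_one_iff)
  then show "0 < kc" "kc\<^sup>2 = 1 - k\<^sup>2" by (auto simp: kc_def)
qed

lemma radicand_pos: "0 < 1 - k\<^sup>2 * (sin \<theta>)\<^sup>2"
proof -
  have "(sin \<theta>)\<^sup>2 \<le> 1" using abs_sin_le_one[of \<theta>] by (simp add: abs_square_le_1)
  then have "k\<^sup>2 * (sin \<theta>)\<^sup>2 \<le> k\<^sup>2 * 1" by (intro mult_left_mono) auto
  moreover have "k\<^sup>2 < 1" using k_pos k_less_1 by (auto simp: power_less_one_iff)
  ultimately show ?thesis by linarith
qed

lemma integrand_ge_1: "1 \<le> 1 / sqrt (1 - k\<^sup>2 * (sin \<theta>)\<^sup>2)"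
proof -
  have "sqrt (1 - k\<^sup>2 * (sin \<theta>)\<^sup>2) \<le> 1" by simp
  moreover have "0 < sqrt (1 - k\<^sup>2 * (sin \<theta>)\<^sup>2)" using radicand_pos by simp
  ultimately show ?thesis by simp
qed

lemma ellipticF_deriv:
  "(ellipticF k has_real_derivative 1 / sqrt (1 - k\<^sup>2 * (sin \<phi>)\<^sup>2)) (at \<phi>)"
proof -
  let ?f = "\<lambda>\<theta>. 1 / sqrt (1 - k\<^sup>2 * (sin \<theta>)\<^sup>2)"
  define r where "r = \<bar>\<phi>\<bar> + 1"
  have cont: "continuous_on {-r..r} ?f"
    using radicand_pos by (intro continuous_intros) (auto simp: less_imp_neq[symmetric])
  have "((\<lambda>u. LBINT y=ereal 0..ereal u. ?f y) has_vector_derivative ?f \<phi>) (at \<phi> within {-r..r})"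
    by (rule interval_integral_FTC2[OF _ _ cont]) (auto simp: r_def)
  moreover have "at \<phi> within {-r..r} = at \<phi>"
    by (rule at_within_Icc_at) (auto simp: r_def)
  ultimately show ?thesis
    unfolding has_real_derivative_iff_has_vector_derivative ellipticF_def[abs_def]
    by (simp add: zero_ereal_def)
qed

lemma ellipticF_0 [simp]: "ellipticF k 0 = 0"
  by (simp add: ellipticF_def zero_ereal_def)

lemma ellipticF_strict_mono:
  assumes "\<phi> < \<psi>" shows "ellipticF k \<phi> < ellipticF k \<psi>"
  using assms
proof (rule DERIV_pos_imp_increasing)
  fix x
  have "0 < 1 / sqrt (1 - k\<^sup>2 * (sin x)\<^sup>2)"
    using integrand_ge_1[of x] by linarith
  then show "\<exists>y. (ellipticF k has_real_derivative y) (at x) \<and> 0 < y"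
    using ellipticF_deriv[of x] by (intro exI conjI)
qed

text \<open>
  The integrand is at least \<open>1\<close>. This is what makes the elliptic integral surjective.
\<close>

lemma ellipticF_expands: "\<phi> \<le> \<psi> \<Longrightarrow> \<psi> - \<phi> \<le> ellipticF k \<psi> - ellipticF k \<phi>"
proof -
  assume le: "\<phi> \<le> \<psi>"
  have "ellipticF k \<phi> - \<phi> \<le> ellipticF k \<psi> - \<psi>"
  proof (rule DERIV_nonneg_imp_nondecreasing[OF le])
    fix x
    have "((\<lambda>x. ellipticF k x - x) has_real_derivative 1 / sqrt (1 - k\<^sup>2 * (sin x)\<^sup>2) - 1) (at x)"
      by (intro DERIV_diff DERIV_ident ellipticF_deriv)
    then show "\<exists>y. ((\<lambda>x. ellipticF k x - x) has_real_derivative y) (at x) \<and> 0 \<le> y"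
      using integrand_ge_1[of x] by auto
  qed
  then show ?thesis by simp
qed

lemma isCont_ellipticF: "isCont (ellipticF k) \<phi>"
  by (rule DERIV_isCont[OF ellipticF_deriv])

lemma ellipticF_surj: "\<exists>\<phi>. ellipticF k \<phi> = u"
proof -
  have "ellipticF k (- \<bar>u\<bar>) \<le> u" using ellipticF_expands[of "-\<bar>u\<bar>" 0] by simp
  moreover have "u \<le> ellipticF k \<bar>u\<bar>" using ellipticF_expands[of 0 "\<bar>u\<bar>"] by simp
  ultimately show ?thesis
    using IVT[of "ellipticF k" "-\<bar>u\<bar>" u "\<bar>u\<bar>"] isCont_ellipticF
    by (metis abs_ge_self abs_ge_zero minus_le_iff neg_le_0_iff_le order_trans)
qed

lemma ellipticF_inj: "ellipticF k \<phi> = ellipticF k \<psi> \<Longrightarrow> \<phi> = \<psi>"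
  using ellipticF_strict_mono[of \<phi> \<psi>] ellipticF_strict_mono[of \<psi> \<phi>] by linarith

lemma ellipticF_am [simp]: "ellipticF k (am u) = u"
proof -
  obtain \<phi> where \<phi>: "ellipticF k \<phi> = u" using ellipticF_surj by blast
  show ?thesis
    unfolding jacobi_am_def
  proof (rule theI)
    show "ellipticF k \<phi> = u" by (rule \<phi>)
    show "\<psi> = \<phi>" if "ellipticF k \<psi> = u" for \<psi>
      by (rule ellipticF_inj) (simp add: that \<phi>)
  qed
qed

lemma am_ellipticF [simp]: "am (ellipticF k \<phi>) = \<phi>"
  by (rule ellipticF_inj) simp

lemma ellipticF_odd: "ellipticF k (- \<phi>) = - ellipticF k \<phi>"
proof -
  have "((\<lambda>x. ellipticF k (-x)) has_real_derivative 1 / sqrt (1 - k\<^sup>2 * (sin (-x))\<^sup>2) * -1) (at x)" for x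
    by (rule DERIV_chain2[where f = "ellipticF k" and g = uminus, OF ellipticF_deriv]) (auto intro!: derivative_eq_intros)
  from DERIV_add[OF this ellipticF_deriv]
  have "((\<lambda>x. ellipticF k (-x) + ellipticF k x) has_real_derivative 0) (at x)" for x
    by simp
  then have "ellipticF k (-\<phi>) + ellipticF k \<phi> = ellipticF k (-0) + ellipticF k 0"
    by (intro DERIV_isconst_all[of "\<lambda>x. ellipticF k (-x) + ellipticF k x"]) simp
  then show ?thesis by simp
qed

lemma ellipticK_eq: "K = ellipticF k (pi / 2)"
  by (simp add: ellipticK_def ellipticF_def)

text \<open>
  The integrand has period \<open>\<pi>\<close>, so the difference is constant; at \<open>- \<pi>/2\<close> oddness gives \<open>2 K\<close>.
\<close>

lemma ellipticF_add_pi: "ellipticF k (\<phi> + pi) = ellipticF k \<phi> + 2 * K"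
proof -
  have "((\<lambda>x. ellipticF k (x + pi)) has_real_derivative 1 / sqrt (1 - k\<^sup>2 * (sin (x + pi))\<^sup>2) * 1) (at x)" for x
    by (rule DERIV_chain2[where f = "ellipticF k" and g = "\<lambda>x. x + pi", OF ellipticF_deriv]) (auto intro!: derivative_eq_intros)
  from DERIV_diff[OF this ellipticF_deriv]
  have "((\<lambda>x. ellipticF k (x + pi) - ellipticF k x) has_real_derivative 0) (at x)" for x
    by simp
  then have *: "ellipticF k (\<phi> + pi) - ellipticF k \<phi>
      = ellipticF k (- (pi / 2) + pi) - ellipticF k (- (pi/2))" for \<phi>
    by (intro DERIV_isconst_all[of "\<lambda>x. ellipticF k (x + pi) - ellipticF k x"]) simp
  have "- (pi / 2) + pi = pi / 2" by simp
  then show ?thesis using *[of \<phi>] by (simp add: ellipticK_eq ellipticF_odd[of "pi/2"])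
qed

lemma K_pos: "0 < K"
  using ellipticF_strict_mono[of 0 "pi/2"] by (simp add: ellipticK_eq)

lemma am_0 [simp]: "am 0 = 0" using am_ellipticF[of 0] by simp
lemma am_minus [simp]: "am (- u) = - am u"
  by (rule ellipticF_inj) (simp add: ellipticF_odd)
lemma am_add_2K: "am (u + 2 * K) = am u + pi"
  by (rule ellipticF_inj) (simp add: ellipticF_add_pi)

lemma am_strict_mono: "u < v \<Longrightarrow> am u < am v"
  using ellipticF_strict_mono[of "am v" "am u"] ellipticF_am[of u] ellipticF_am[of v]
  by (cases "am u" "am v" rule: linorder_cases) auto

lemma isCont_am: "isCont am u"
proof -
  have "isCont am (ellipticF k (am u))"
    by (rule isCont_inverse_function[where f = "ellipticF k" and d = 1])
      (simp_all add: isCont_ellipticF)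
  then show ?thesis by simp
qed

lemma dn_pos: "0 < dn u" and dn_sq: "(dn u)\<^sup>2 = 1 - k\<^sup>2 * (sn u)\<^sup>2"
  using radicand_pos[of "am u"] by (simp_all add: jacobi_dn_def jacobi_sn_def)

lemma cn_sq: "(cn u)\<^sup>2 = 1 - (sn u)\<^sup>2"
  by (simp add: jacobi_cn_def jacobi_sn_def cos_squared_eq)

lemma am_deriv: "(am has_real_derivative dn u) (at u)"
proof -
  have "(am has_real_derivative inverse (1 / dn u)) (at u)"
  proof (rule DERIV_inverse_function[of "ellipticF k"])
    show "(ellipticF k has_real_derivative 1 / dn u) (at (am u))"
      using ellipticF_deriv[of "am u"] by (simp add: jacobi_dn_def jacobi_sn_def)
    show "1 / dn u \<noteq> 0" using dn_pos[of u] by simp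
    show "u - 1 < u" "u < u + 1" by auto
  qed (auto intro: isCont_am)
  then show ?thesis by simp
qed

lemma sn_deriv: "(sn has_real_derivative cn u * dn u) (at u)"
proof -
  have "((\<lambda>u. sin (am u)) has_real_derivative cos (am u) * dn u) (at u)"
    by (rule DERIV_chain2[where f = sin and g = am, OF DERIV_sin am_deriv])
  then show ?thesis by (simp only: jacobi_sn_def[abs_def] jacobi_cn_def)
qed

lemma cn_deriv: "(cn has_real_derivative - sn u * dn u) (at u)"
proof -
  have "((\<lambda>u. cos (am u)) has_real_derivative - sin (am u) * dn u) (at u)"
    by (rule DERIV_chain2[where f = cos and g = am, OF DERIV_cos am_deriv])
  then show ?thesis by (simp only: jacobi_cn_def[abs_def] jacobi_sn_def)
qed


lemma dn_deriv: "(dn has_real_derivative - k\<^sup>2 * sn u * cn u) (at u)"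
proof -
  have "((\<lambda>u. 1 - k\<^sup>2 * (sn u)\<^sup>2) has_real_derivative
      0 - k\<^sup>2 * (of_nat 2 * (cn u * dn u * sn u ^ (2 - Suc 0)))) (at u)"
    by (rule DERIV_diff[OF DERIV_const DERIV_cmult[OF DERIV_power[OF sn_deriv]]])
  then have D: "((\<lambda>u. 1 - k\<^sup>2 * (sn u)\<^sup>2) has_real_derivative
      - (2 * k\<^sup>2 * sn u * cn u * dn u)) (at u)"
    by (rule DERIV_cong) simp
  have pos: "0 < 1 - k\<^sup>2 * (sn u)\<^sup>2"
    using radicand_pos[of "am u"] by (simp only: jacobi_sn_def)
  have "((\<lambda>u. sqrt (1 - k\<^sup>2 * (sn u)\<^sup>2)) has_real_derivative
      inverse (sqrt (1 - k\<^sup>2 * (sn u)\<^sup>2)) / 2 * - (2 * k\<^sup>2 * sn u * cn u * dn u)) (at u)"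
    by (rule DERIV_chain2[where f = sqrt and g = "\<lambda>u. 1 - k\<^sup>2 * (sn u)\<^sup>2", OF DERIV_real_sqrt[OF pos] D])
  moreover have "inverse (sqrt (1 - k\<^sup>2 * (sn u)\<^sup>2)) / 2 * - (2 * k\<^sup>2 * sn u * cn u * dn u)
      = - k\<^sup>2 * sn u * cn u"
    using dn_pos[of u] by (simp add: jacobi_dn_def[symmetric])
  ultimately show ?thesis
    by (simp only: jacobi_dn_def[abs_def])
qed

lemmas jacobi_DERIV [derivative_intros] =
  am_deriv[THEN DERIV_chain2] sn_deriv[THEN DERIV_chain2]
  cn_deriv[THEN DERIV_chain2] dn_deriv[THEN DERIV_chain2]

lemma jacobi_0 [simp]: "sn 0 = 0" "cn 0 = 1" "dn 0 = 1"
  by (simp_all add: jacobi_sn_def jacobi_cn_def jacobi_dn_def)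
lemma jacobi_minus [simp]: "sn (- u) = - sn u" "cn (- u) = cn u" "dn (- u) = dn u"
  by (simp_all add: jacobi_sn_def jacobi_cn_def jacobi_dn_def)
lemma jacobi_add_2K: "sn (u + 2 * K) = - sn u" "cn (u + 2 * K) = - cn u" "dn (u + 2 * K) = dn u"
  by (simp_all add: jacobi_sn_def jacobi_cn_def jacobi_dn_def am_add_2K)

lemma sn_pos: "0 < u \<Longrightarrow> u < 2 * K \<Longrightarrow> 0 < sn u"
  using am_strict_mono[of 0 u] am_strict_mono[of u "2*K"] am_add_2K[of 0]
  by (auto simp: jacobi_sn_def intro: sin_gt_zero)

section \<open>The addition theorems for cn and dn\<close>

text \<open>
  With \<open>w = u + v\<close> fixed, the right-hand sides, read as functions of \<open>u\<close>, have derivative zero;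
  their value at \<open>u = 0\<close> is \<open>cn w\<close> or \<open>dn w\<close>.
\<close>

lemma
  fixes u v :: real
  defines "\<Delta> \<equiv> 1 - k\<^sup>2 * (sn u)\<^sup>2 * (sn v)\<^sup>2"
  shows addition_denominator_pos: "0 < \<Delta>"
    and cn_add: "cn (u + v) = (cn u * cn v - sn u * sn v * dn u * dn v) / \<Delta>"
    and dn_add: "dn (u + v) = (dn u * dn v - k\<^sup>2 * sn u * sn v * cn u * cn v) / \<Delta>"
proof -
  have D: "0 < 1 - k\<^sup>2 * (sn u)\<^sup>2 * (sn v)\<^sup>2" for u v
  proof -
    have "(sn u)\<^sup>2 * (sn v)\<^sup>2 \<le> (sn u)\<^sup>2 * 1"
      by (intro mult_left_mono) (auto simp: jacobi_sn_def abs_square_le_1)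
    then have "k\<^sup>2 * ((sn u)\<^sup>2 * (sn v)\<^sup>2) \<le> k\<^sup>2 * (sn u)\<^sup>2" by (intro mult_left_mono) auto
    moreover have "0 < 1 - k\<^sup>2 * (sn u)\<^sup>2" using radicand_pos by (simp add: jacobi_sn_def)
    ultimately show ?thesis by (simp add: mult.assoc)
  qed
  then show "0 < \<Delta>" by (simp add: \<Delta>_def)
  define w where "w = u + v"
  let ?D = "\<lambda>x. 1 - k\<^sup>2 * (sn x)\<^sup>2 * (sn (w - x))\<^sup>2"
  let ?C = "\<lambda>x. (cn x * cn (w - x) - sn x * sn (w - x) * dn x * dn (w - x)) / ?D x"
  let ?E = "\<lambda>x. (dn x * dn (w - x) - k\<^sup>2 * sn x * sn (w - x) * cn x * cn (w - x)) / ?D x"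
  have "(?C has_real_derivative 0) (at x)" for x
  proof -
    define s c d s2 c2 d2 where "s = sn x" "c = cn x" "d = dn x"
      and "s2 = sn (w-x)" "c2 = cn (w-x)" "d2 = dn (w-x)"
    note defs = this
    have r: "c\<^sup>2 = 1 - s\<^sup>2" "c2\<^sup>2 = 1 - s2\<^sup>2" "d\<^sup>2 = 1 - k\<^sup>2 * s\<^sup>2" "d2\<^sup>2 = 1 - k\<^sup>2 * s2\<^sup>2"
      by (auto simp: defs cn_sq dn_sq)
    have D0: "1 - k\<^sup>2 * s\<^sup>2 * s2\<^sup>2 \<noteq> 0" using D[of x "w-x"] by (simp add: defs)
    \<comment> \<open>The derivatives of numerator and denominator; a trailing 2 marks the argument \<open>w - x\<close>.\<close>
    let ?Nd = "- s * d * c2 + c * s2 * d2 - (c * d * s2 * d * d2 - s * c2 * d2 * d * d2 - s * s2 * k\<^sup>2 * s * c * d2 + s * s2 * d * k\<^sup>2 * s2 * c2)"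
    let ?Dd = "- k\<^sup>2 * (2 * s * c * d * s2\<^sup>2 - s\<^sup>2 * 2 * s2 * c2 * d2)"
    have "(?C has_real_derivative (?Nd * (1 - k\<^sup>2 * s\<^sup>2 * s2\<^sup>2) - (c * c2 - s * s2 * d * d2) * ?Dd)
       / ((1 - k\<^sup>2 * s\<^sup>2 * s2\<^sup>2) * (1 - k\<^sup>2 * s\<^sup>2 * s2\<^sup>2))) (at x)"
      using D0 unfolding defs
      by (auto intro!: derivative_eq_intros simp: algebra_simps power2_eq_square)
    moreover have "?Nd * (1 - k\<^sup>2 * s\<^sup>2 * s2\<^sup>2) - (c * c2 - s * s2 * d * d2) * ?Dd = 0"
    proof -
      let ?\<Delta> = "1 - k\<^sup>2 * s\<^sup>2 * s2\<^sup>2"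
      have "?Nd = - s * d * c2 + c * s2 * d2 - c * s2 * d2 * d\<^sup>2 + s * c2 * d * d2\<^sup>2 + k\<^sup>2 * s\<^sup>2 * s2 * c * d2 - k\<^sup>2 * s * s2\<^sup>2 * c2 * d"
        by (simp add: algebra_simps power2_eq_square)
      also have "\<dots> = 2 * k\<^sup>2 * s * s2 * (s * c * d2 - s2 * c2 * d)"
        unfolding r by (simp add: algebra_simps power2_eq_square)
      finally have N: "?Nd = 2 * k\<^sup>2 * s * s2 * (s * c * d2 - s2 * c2 * d)" .
      have "(c * c2 - s * s2 * d * d2) * (c * d * s2 - s * c2 * d2)
          = c2 * d * s2 * (c\<^sup>2 + s\<^sup>2 * d2\<^sup>2) - s * c * d2 * (c2\<^sup>2 + s2\<^sup>2 * d\<^sup>2)"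
        by (simp add: algebra_simps power2_eq_square)
      also have "c\<^sup>2 + s\<^sup>2 * d2\<^sup>2 = ?\<Delta>" unfolding r by (simp add: algebra_simps)
      also have "c2\<^sup>2 + s2\<^sup>2 * d\<^sup>2 = ?\<Delta>" unfolding r by (simp add: algebra_simps)
      finally have "(c * c2 - s * s2 * d * d2) * (c * d * s2 - s * c2 * d2) = (c2 * d * s2 - s * c * d2) * ?\<Delta>"
        by (simp add: algebra_simps)
      moreover have "?Dd = - (2 * k\<^sup>2 * s * s2) * (c * d * s2 - s * c2 * d2)"
        by (simp add: algebra_simps power2_eq_square)
      ultimately have P: "(c * c2 - s * s2 * d * d2) * ?Dd = - (2 * k\<^sup>2 * s * s2) * ((c2 * d * s2 - s * c * d2) * ?\<Delta>)"
        by (metis mult.left_commute)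
      show ?thesis unfolding N P by (simp add: algebra_simps)
    qed
    ultimately show ?thesis by simp
  qed
  then have "?C u = ?C 0" using DERIV_isconst_all[of ?C] by blast
  then show "cn (u + v) = (cn u * cn v - sn u * sn v * dn u * dn v) / \<Delta>"
    by (simp add: w_def \<Delta>_def)
  have "(?E has_real_derivative 0) (at x)" for x
  proof -
    define s c d s2 c2 d2 where "s = sn x" "c = cn x" "d = dn x"
      and "s2 = sn (w-x)" "c2 = cn (w-x)" "d2 = dn (w-x)"
    note defs = this
    have r: "c\<^sup>2 = 1 - s\<^sup>2" "c2\<^sup>2 = 1 - s2\<^sup>2" "d\<^sup>2 = 1 - k\<^sup>2 * s\<^sup>2" "d2\<^sup>2 = 1 - k\<^sup>2 * s2\<^sup>2"
      by (auto simp: defs cn_sq dn_sq)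
    have D0: "1 - k\<^sup>2 * s\<^sup>2 * s2\<^sup>2 \<noteq> 0" using D[of x "w-x"] by (simp add: defs)
    let ?Nd = "- k\<^sup>2 * s * c * d2 + d * k\<^sup>2 * s2 * c2 - k\<^sup>2 * (c * d * s2 * c * c2 - s * c2 * d2 * c * c2 - s * s2 * s * d * c2 + s * s2 * c * s2 * d2)"
    let ?Dd = "- k\<^sup>2 * (2 * s * c * d * s2\<^sup>2 - s\<^sup>2 * 2 * s2 * c2 * d2)"
    have "(?E has_real_derivative (?Nd * (1 - k\<^sup>2 * s\<^sup>2 * s2\<^sup>2) - (d * d2 - k\<^sup>2 * s * s2 * c * c2) * ?Dd)
       / ((1 - k\<^sup>2 * s\<^sup>2 * s2\<^sup>2) * (1 - k\<^sup>2 * s\<^sup>2 * s2\<^sup>2))) (at x)"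
      using D0 unfolding defs
      by (auto intro!: derivative_eq_intros simp: algebra_simps power2_eq_square)
    moreover have "?Nd * (1 - k\<^sup>2 * s\<^sup>2 * s2\<^sup>2) - (d * d2 - k\<^sup>2 * s * s2 * c * c2) * ?Dd = 0"
    proof -
      let ?\<Delta> = "1 - k\<^sup>2 * s\<^sup>2 * s2\<^sup>2"
      have "?Nd = k\<^sup>2 * (- s * c * d2 + d * s2 * c2 - d * s2 * c2 * c\<^sup>2 + s * c * d2 * c2\<^sup>2 + s\<^sup>2 * s2 * d * c2 - s * s2\<^sup>2 * c * d2)"
        by (simp add: algebra_simps power2_eq_square)
      also have "\<dots> = 2 * k\<^sup>2 * s * s2 * (s * d * c2 - s2 * c * d2)"
        unfolding r by (simp add: algebra_simps power2_eq_square)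
      finally have N: "?Nd = 2 * k\<^sup>2 * s * s2 * (s * d * c2 - s2 * c * d2)" .
      have "(d * d2 - k\<^sup>2 * s * s2 * c * c2) * (c * d * s2 - s * c2 * d2)
          = s2 * c * d2 * (d\<^sup>2 + k\<^sup>2 * s\<^sup>2 * c2\<^sup>2) - s * c2 * d * (d2\<^sup>2 + k\<^sup>2 * s2\<^sup>2 * c\<^sup>2)"
        by (simp add: algebra_simps power2_eq_square)
      also have "d\<^sup>2 + k\<^sup>2 * s\<^sup>2 * c2\<^sup>2 = ?\<Delta>" unfolding r by (simp add: algebra_simps)
      also have "d2\<^sup>2 + k\<^sup>2 * s2\<^sup>2 * c\<^sup>2 = ?\<Delta>" unfolding r by (simp add: algebra_simps)
      finally have "(d * d2 - k\<^sup>2 * s * s2 * c * c2) * (c * d * s2 - s * c2 * d2) = (s2 * c * d2 - s * c2 * d) * ?\<Delta>"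
        by (simp add: algebra_simps)
      moreover have "?Dd = - (2 * k\<^sup>2 * s * s2) * (c * d * s2 - s * c2 * d2)"
        by (simp add: algebra_simps power2_eq_square)
      ultimately have P: "(d * d2 - k\<^sup>2 * s * s2 * c * c2) * ?Dd = - (2 * k\<^sup>2 * s * s2) * ((s2 * c * d2 - s * c2 * d) * ?\<Delta>)"
        by (metis mult.left_commute)
      show ?thesis unfolding N P by (simp add: algebra_simps)
    qed
    ultimately show ?thesis by simp
  qed
  then have "?E u = ?E 0" using DERIV_isconst_all[of ?E] by blast
  then show "dn (u + v) = (dn u * dn v - k\<^sup>2 * sn u * sn v * cn u * cn v) / \<Delta>"
    by (simp add: w_def \<Delta>_def)
qed

end

section \<open>A linear fractional factor on the arc\<close>

lemma has_vector_derivative_cis: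
  assumes "(f has_real_derivative d) (at x)"
  shows "((\<lambda>x. cis (f x)) has_vector_derivative of_real d * (\<i> * cis (f x))) (at x)"
proof -
  have "(\<lambda>h. h * d) = (*) d" by (auto simp: mult.commute)
  then have "(f has_derivative (\<lambda>h. h * d)) (at x)"
    using assms by (simp add: has_field_derivative_def)
  from has_derivative_cis[OF this] show ?thesis
    by (simp add: has_vector_derivative_def scaleR_conv_of_real mult.assoc)
qed

context elliptic_modulus begin

text \<open>
  The numerator in the coefficients of the statement: these are \<open>\<beta> / cn\<close> and \<open>cn / \<beta>\<close>.
\<close>

definition \<beta> :: "real \<Rightarrow> real" where "\<beta> a = kc * sn a + dn a"

text \<open>
  The point \<open>cis (\<omega> v)\<close> is the point of the arc with elliptic coordinate \<open>v\<close>; \<open>v = 0\<close> gives its upper end.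
\<close>

definition \<omega> :: "real \<Rightarrow> real" where "\<omega> v = arcsin (k * cn v / dn v)"

text \<open>
  A primitive of \<open>dn + k cn\<close>, an elliptic function with simple poles at \<open>\<i> K'\<close> and \<open>- \<i> K'\<close> modulo
  \<open>4 K\<close> and \<open>4 \<i> K'\<close>. Its translates by \<open>a\<close> and by \<open>- a\<close> together have the poles of the logarithmic
  derivative of a factor of \<open>s\<^sub>m\<close>.
\<close>

definition A :: "real \<Rightarrow> real" where "A x = am x + arcsin (k * sn x)"

lemma dn_sq_minus: "(dn v)\<^sup>2 - k\<^sup>2 * (cn v)\<^sup>2 = kc\<^sup>2"
  by (simp add: dn_sq cn_sq kc_sq algebra_simps)

lemma sin_\<omega>_sq: "1 - (k * cn v / dn v)\<^sup>2 = (kc / dn v)\<^sup>2"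
proof -
  have "1 - (k * cn v / dn v)\<^sup>2 = ((dn v)\<^sup>2 - k\<^sup>2 * (cn v)\<^sup>2) / (dn v)\<^sup>2"
    using dn_pos[of v] by (simp add: power_divide power_mult_distrib diff_divide_distrib)
  then show ?thesis by (simp add: dn_sq_minus power_divide)
qed

lemma sin_\<omega>_bounds: "- 1 < k * cn v / dn v" "k * cn v / dn v < 1"
proof -
  have "0 < (kc / dn v)\<^sup>2" using kc_pos dn_pos[of v] by simp
  then have "(k * cn v / dn v)\<^sup>2 < 1" using sin_\<omega>_sq[of v] by linarith
  then show "- 1 < k * cn v / dn v" "k * cn v / dn v < 1"
    using abs_square_less_1[of "k * cn v / dn v"] unfolding abs_less_iff by linarith+
qed

lemma sin_\<omega>: "sin (\<omega> v) = k * cn v / dn v"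
  using sin_\<omega>_bounds[of v] by (simp add: \<omega>_def)

lemma cos_\<omega>: "cos (\<omega> v) = kc / dn v"
proof -
  have "cos (\<omega> v) = sqrt (1 - (k * cn v / dn v)\<^sup>2)"
    using sin_\<omega>_bounds[of v] by (simp add: \<omega>_def cos_arcsin)
  then show ?thesis unfolding sin_\<omega>_sq using kc_pos dn_pos[of v] by simp
qed

lemma \<omega>_deriv: "(\<omega> has_real_derivative - (k * kc * sn v / dn v)) (at v)"
proof -
  have d: "dn v \<noteq> 0" using dn_pos[of v] by simp
  have "((\<lambda>v. k * cn v / dn v) has_real_derivative
      ((k * (- sn v * dn v)) * dn v - (k * cn v) * (- k\<^sup>2 * sn v * cn v)) / (dn v * dn v)) (at v)"
    by (rule DERIV_divide[OF DERIV_cmult[OF cn_deriv] dn_deriv d])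
  moreover have "((k * (- sn v * dn v)) * dn v - (k * cn v) * (- k\<^sup>2 * sn v * cn v))
      = - (k * sn v * ((dn v)\<^sup>2 - k\<^sup>2 * (cn v)\<^sup>2))"
    by (simp add: algebra_simps power2_eq_square)
  ultimately have "((\<lambda>v. k * cn v / dn v) has_real_derivative - (k * sn v * kc\<^sup>2) / (dn v * dn v)) (at v)"
    by (simp add: dn_sq_minus)
  from DERIV_chain2[where f = arcsin and g = "\<lambda>v. k * cn v / dn v", OF DERIV_arcsin[OF sin_\<omega>_bounds] this]
  have "(\<omega> has_real_derivative
      inverse (sqrt (1 - (k * cn v / dn v)\<^sup>2)) * (- (k * sn v * kc\<^sup>2) / (dn v * dn v))) (at v)"
    unfolding \<omega>_def[abs_def] .
  moreover have "inverse (sqrt (1 - (k * cn v / dn v)\<^sup>2)) * (- (k * sn v * kc\<^sup>2) / (dn v * dn v))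
      = - (k * kc * sn v / dn v)"
  proof -
    have "sqrt ((kc / dn v)\<^sup>2) = kc / dn v" using kc_pos dn_pos[of v] by simp
    then show ?thesis
      unfolding sin_\<omega>_sq using kc_pos dn_pos[of v] by (simp add: power2_eq_square)
  qed
  ultimately show ?thesis by simp
qed

lemma A_deriv: "(A has_real_derivative dn x + k * cn x) (at x)"
proof -
  have s: "1 - (k * sn x)\<^sup>2 = (dn x)\<^sup>2" by (simp add: dn_sq power_mult_distrib)
  then have "(k * sn x)\<^sup>2 < 1" using dn_pos[of x] by (smt (verit) zero_less_power)
  then have b: "- 1 < k * sn x" "k * sn x < 1" by (auto simp: abs_square_less_1 abs_less_iff)
  have "((\<lambda>x. arcsin (k * sn x)) has_real_derivative
      inverse (sqrt (1 - (k * sn x)\<^sup>2)) * (k * (cn x * dn x))) (at x)"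
    by (rule DERIV_chain2[where f = arcsin and g = "\<lambda>v. k * sn v", OF DERIV_arcsin[OF b] DERIV_cmult[OF sn_deriv]])
  then have "((\<lambda>x. arcsin (k * sn x)) has_real_derivative k * cn x) (at x)"
    unfolding s using dn_pos[of x] by (elim DERIV_cong) simp
  from DERIV_add[OF am_deriv this] show ?thesis by (simp add: A_def[abs_def])
qed

lemma cis_A: "cis (A x) = (cn x + \<i> * sn x) * (dn x + \<i> * (k * sn x))"
proof -
  have s: "1 - (k * sn x)\<^sup>2 = (dn x)\<^sup>2" by (simp add: dn_sq power_mult_distrib)
  then have "(k * sn x)\<^sup>2 < 1" using dn_pos[of x] by (smt (verit) zero_less_power)
  then have b: "- 1 \<le> k * sn x" "k * sn x \<le> 1" by (auto simp: abs_square_less_1 abs_less_iff)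
  have "cos (arcsin (k * sn x)) = dn x"
    unfolding cos_arcsin[OF b] s using dn_pos[of x] by simp
  then have "cis (arcsin (k * sn x)) = dn x + \<i> * (k * sn x)"
    using b by (simp add: complex_eq_iff)
  moreover have "cis (am x) = cn x + \<i> * sn x"
    by (simp add: complex_eq_iff jacobi_cn_def jacobi_sn_def)
  ultimately show ?thesis by (simp add: A_def cis_mult[symmetric])
qed

lemma A_minus [simp]: "A (- x) = - A x"
proof -
  have s: "1 - (k * sn x)\<^sup>2 = (dn x)\<^sup>2" by (simp add: dn_sq power_mult_distrib)
  then have "(k * sn x)\<^sup>2 \<le> 1" using dn_pos[of x] by (smt (verit) zero_le_power2)
  then have b: "- 1 \<le> k * sn x" "k * sn x \<le> 1" by (auto simp: abs_square_le_1 abs_le_iff)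
  then show ?thesis by (simp add: A_def arcsin_minus)
qed

lemma A_0 [simp]: "A 0 = 0" by (simp add: A_def)

lemma A_2K: "A (2 * K) = pi"
  using am_add_2K[of 0] jacobi_add_2K[of 0] by (simp add: A_def)

lemma A_add_4K: "A (x + 4 * K) = A x + 2 * pi"
proof -
  have "x + 4 * K = (x + 2 * K) + 2 * K" by simp
  then show ?thesis
    by (simp only: A_def am_add_2K jacobi_add_2K) simp
qed

lemma A_strict_mono:
  assumes "x < y" shows "A x < A y"
  using assms
proof (rule DERIV_pos_imp_increasing)
  fix x
  have "kc\<^sup>2 > 0" using kc_pos by (rule zero_less_power)
  then have "(k * cn x)\<^sup>2 < (dn x)\<^sup>2"
    using dn_sq_minus[of x] unfolding power_mult_distrib by linarith
  then have "\<bar>k * cn x\<bar> < \<bar>dn x\<bar>"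
    by (metis abs_le_square_iff not_le)
  then have "\<bar>k * cn x\<bar> < dn x" using dn_pos[of x] by simp
  then have "0 < dn x + k * cn x" by linarith
  then show "\<exists>y. (A has_real_derivative y) (at x) \<and> 0 < y"
    using A_deriv[of x] by (intro exI conjI)
qed

text \<open>
  Both follow from \<open>cn\<^sup>2 = (dn - kc sn) (dn + kc sn)\<close>, whose second factor is \<open>\<beta>\<close>.
\<close>

lemma \<beta>_sum_sq: "(cn a)\<^sup>2 + (\<beta> a)\<^sup>2 = 2 * dn a * \<beta> a"
  and \<beta>_diff_sq: "(cn a)\<^sup>2 - (\<beta> a)\<^sup>2 = - (2 * kc * sn a * \<beta> a)"
proof -
  have "(cn a)\<^sup>2 = (dn a)\<^sup>2 - kc\<^sup>2 * (sn a)\<^sup>2" by (simp add: cn_sq dn_sq kc_sq algebra_simps)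
  then show "(cn a)\<^sup>2 + (\<beta> a)\<^sup>2 = 2 * dn a * \<beta> a" "(cn a)\<^sup>2 - (\<beta> a)\<^sup>2 = - (2 * kc * sn a * \<beta> a)"
    by (simp_all add: \<beta>_def algebra_simps power2_eq_square)
qed

lemma \<beta>_pos: "0 \<le> sn a \<Longrightarrow> 0 < \<beta> a"
  using kc_pos dn_pos[of a] by (simp add: \<beta>_def add_nonneg_pos)

lemma abs_cn_less_\<beta>:
  assumes "0 < sn a" shows "\<bar>cn a\<bar> < \<beta> a"
proof -
  have "0 < 2 * kc * sn a * \<beta> a" using assms kc_pos \<beta>_pos[of a] by simp
  then have "(cn a)\<^sup>2 < (\<beta> a)\<^sup>2" using \<beta>_diff_sq[of a] by linarith
  then show ?thesis using \<beta>_pos[of a] assms by (metis abs_of_pos less_imp_le power2_abs power2_less_imp_less)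
qed

text \<open>
  On the unit circle the term with \<open>\<beta>\<close> dominates, by \<open>abs_cn_less_\<beta>\<close>.
\<close>

lemma factor_denominator_nonzero:
  assumes "0 < sn a" "cmod z = 1"
  shows "of_real (cn a) + \<i> * of_real (\<beta> a) * z \<noteq> 0"
proof -
  have "cmod (of_real (cn a)) < cmod (\<i> * of_real (\<beta> a) * z)"
    using abs_cn_less_\<beta>[OF assms(1)] assms(2) by (simp add: norm_mult)
  then show ?thesis
    by (metis add_eq_0_iff2 norm_minus_cancel order_less_irrefl)
qed

text \<open>
  The addition theorems combined. The point is the factorisation
  \<open>kc\<^sup>2 (1 - k\<^sup>2 sn\<^sup>2 v sn\<^sup>2 a) = (dn v dn a - k cn v cn a) (dn v dn a + k cn v cn a)\<close>, which lets the
  denominator of the addition theorems cancel.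
\<close>

lemma half_A_deriv_diff:
  "k * kc\<^sup>2 * sn v * sn a = (dn v * dn a - k * cn v * cn a) *
     ((dn (v - a) + k * cn (v - a)) - (dn (v + a) + k * cn (v + a))) / 2"
proof -
  let ?\<Delta> = "1 - k\<^sup>2 * (sn v)\<^sup>2 * (sn a)\<^sup>2"
  have \<Delta>: "?\<Delta> \<noteq> 0" using addition_denominator_pos[of v a] by simp
  have "?\<Delta> * kc\<^sup>2 = (dn v)\<^sup>2 * (dn a)\<^sup>2 - k\<^sup>2 * (cn v)\<^sup>2 * (cn a)\<^sup>2"
    unfolding dn_sq cn_sq kc_sq by (simp add: algebra_simps)
  then have "kc\<^sup>2 * ?\<Delta> = (dn v * dn a - k * cn v * cn a) * (dn v * dn a + k * cn v * cn a)"
    by (simp add: algebra_simps power2_eq_square)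
  then have kc: "kc\<^sup>2 = (dn v * dn a - k * cn v * cn a) * (dn v * dn a + k * cn v * cn a) / ?\<Delta>"
    using \<Delta> by (metis eq_divide_eq)
  have "dn (v - a) - dn (v + a) = 2 * k\<^sup>2 * sn v * sn a * cn v * cn a / ?\<Delta>"
    using dn_add[of v "- a"] dn_add[of v a] by (simp add: diff_divide_distrib[symmetric])
  moreover have "cn (v - a) - cn (v + a) = 2 * sn v * sn a * dn v * dn a / ?\<Delta>"
    using cn_add[of v "- a"] cn_add[of v a] by (simp add: diff_divide_distrib[symmetric])
  ultimately have "((dn (v - a) + k * cn (v - a)) - (dn (v + a) + k * cn (v + a)))
      = 2 * k\<^sup>2 * sn v * sn a * cn v * cn a / ?\<Delta> + k * (2 * sn v * sn a * dn v * dn a / ?\<Delta>)"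
    by (simp add: algebra_simps)
  also have "\<dots> = 2 * (k * sn v * sn a) * (dn v * dn a + k * cn v * cn a) / ?\<Delta>"
    by (simp add: add_divide_distrib[symmetric] algebra_simps power2_eq_square)
  finally have e: "((dn (v - a) + k * cn (v - a)) - (dn (v + a) + k * cn (v + a)))
      = 2 * (k * sn v * sn a) * (dn v * dn a + k * cn v * cn a) / ?\<Delta>" .
  have "k * (p * q / D) * s * t = p * (2 * (k * s * t) * q / D) / 2" for p q D s t :: real
    by simp
  then show ?thesis unfolding e unfolding kc .
qed

text \<open>
  The exponential is chosen so that its logarithmic derivative is opposite to that of the factor:
  the latter is \<open>\<i> \<omega>' (cn\<^sup>2 a - \<beta>\<^sup>2) / (cn\<^sup>2 a + \<beta>\<^sup>2 - 2 \<beta> cn a sin (\<omega> v))\<close>, which \<open>half_A_deriv_diff\<close>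
  identifies with \<open>\<i> (A' (v - a) - A' (v + a)) / 2\<close>.
\<close>

lemma factor_on_arc_deriv:
  assumes "0 < sn a"
  defines "N \<equiv> \<lambda>z. (of_real (cn a) * z - \<i> * of_real (\<beta> a)) / (of_real (cn a) + \<i> * of_real (\<beta> a) * z)"
  shows "((\<lambda>v. N (cis (\<omega> v)) * cis (- ((A (v - a) - A (v + a)) / 2))) has_vector_derivative 0) (at v)"
proof -
  define z where "z = cis (\<omega> v)"
  define M where "M = of_real (cn a) + \<i> * of_real (\<beta> a) * z"
  define T where "T = of_real (cn a) * z - \<i> * of_real (\<beta> a)"
  define E where "E = cis (- ((A (v - a) - A (v + a)) / 2))"
  define h where "h = ((dn (v - a) + k * cn (v - a)) - (dn (v + a) + k * cn (v + a))) / 2"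
  define w' where "w' = - (k * kc * sn v / dn v)"
  have z1: "z * cnj z = 1" by (simp add: z_def flip: complex_norm_square)
  have M0: "M \<noteq> 0"
    unfolding M_def by (rule factor_denominator_nonzero[OF assms(1)]) (simp add: z_def)
  have Mz0: "of_real (cn a) + \<i> * of_real (\<beta> a) * cis (\<omega> v) \<noteq> 0" using M0 by (simp add: M_def z_def)
  have dz: "((\<lambda>v. cis (\<omega> v)) has_vector_derivative of_real w' * (\<i> * z)) (at v)"
    unfolding z_def w'_def
    by (rule has_vector_derivative_cis[OF \<omega>_deriv])
  have NF: "(N has_field_derivative of_real ((cn a)\<^sup>2 - (\<beta> a)\<^sup>2) / (M * M)) (at (cis (\<omega> v)))"
  proof -
    have "(N has_field_derivative (of_real (cn a) * M - T * (\<i> * of_real (\<beta> a))) / (M * M)) (at (cis (\<omega> v)))"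
      unfolding N_def using Mz0
      by (auto intro!: derivative_eq_intros simp: M_def T_def z_def)
    moreover have "of_real (cn a) * M - T * (\<i> * of_real (\<beta> a)) = of_real ((cn a)\<^sup>2 - (\<beta> a)\<^sup>2)"
      by (simp add: M_def T_def algebra_simps power2_eq_square)
    ultimately show ?thesis by simp
  qed
  have dN: "((\<lambda>v. N (cis (\<omega> v))) has_vector_derivative
      of_real w' * (\<i> * z) * (of_real ((cn a)\<^sup>2 - (\<beta> a)\<^sup>2) / (M * M))) (at v)"
    using field_vector_diff_chain_at[OF dz NF] by (simp add: o_def)
  have "((\<lambda>v. - ((A (v - a) - A (v + a)) / 2)) has_real_derivative
      - (((dn (v - a) + k * cn (v - a)) * 1 - (dn (v + a) + k * cn (v + a)) * 1) / 2)) (at v)"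
    by (intro DERIV_minus DERIV_cdivide DERIV_diff
        DERIV_chain2[where f = A and g = "\<lambda>v. v - a", OF A_deriv]
        DERIV_chain2[where f = A and g = "\<lambda>v. v + a", OF A_deriv])
      (auto intro!: derivative_eq_intros)
  then have "((\<lambda>v. - ((A (v - a) - A (v + a)) / 2)) has_real_derivative - h) (at v)"
    by (simp add: h_def)
  from has_vector_derivative_cis[OF this]
  have dE: "((\<lambda>v. cis (- ((A (v - a) - A (v + a)) / 2))) has_vector_derivative
      of_real (- h) * (\<i> * E)) (at v)"
    by (simp add: E_def)
  \<comment> \<open>On the unit circle \<open>z - 1 / z = 2 \<i> Im z\<close>.\<close>
  have z2: "z * z - 1 = z * (2 * \<i> * of_real (k * cn v / dn v))"
  proof -
    have "z - cnj z = 2 * \<i> * of_real (k * cn v / dn v)"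
      by (simp add: z_def complex_eq_iff sin_\<omega>)
    moreover have "z * z - 1 = z * (z - cnj z)" using z1 by (simp add: algebra_simps)
    ultimately show ?thesis by simp
  qed
  have TM: "T * M = z * of_real ((cn a)\<^sup>2 + (\<beta> a)\<^sup>2 - 2 * cn a * \<beta> a * (k * cn v / dn v))"
  proof -
    have "T * M = z * of_real ((cn a)\<^sup>2 + (\<beta> a)\<^sup>2) + \<i> * of_real (cn a * \<beta> a) * (z * z - 1)"
      by (simp add: T_def M_def algebra_simps power2_eq_square)
    then show ?thesis unfolding z2 by (simp add: algebra_simps)
  qed
  have "w' * ((cn a)\<^sup>2 - (\<beta> a)\<^sup>2) = ((cn a)\<^sup>2 + (\<beta> a)\<^sup>2 - 2 * cn a * \<beta> a * (k * cn v / dn v)) * h"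
  proof -
    have "w' * ((cn a)\<^sup>2 - (\<beta> a)\<^sup>2) = 2 * \<beta> a / dn v * (k * kc\<^sup>2 * sn v * sn a)"
      unfolding \<beta>_diff_sq w'_def by (simp add: power2_eq_square)
    also have "\<dots> = 2 * \<beta> a / dn v * ((dn v * dn a - k * cn v * cn a) * h)"
      unfolding half_A_deriv_diff by (simp add: h_def)
    also have "\<dots> = (2 * dn a * \<beta> a - 2 * cn a * \<beta> a * (k * cn v / dn v)) * h"
      using dn_pos[of v] by (simp add: field_simps)
    finally show ?thesis by (simp add: \<beta>_sum_sq)
  qed
  from arg_cong[OF this, of "\<lambda>x. \<i> * z * of_real x"]
  have key: "of_real w' * (\<i> * z) * of_real ((cn a)\<^sup>2 - (\<beta> a)\<^sup>2) = \<i> * of_real h * (T * M)"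
    unfolding TM of_real_mult by (simp only: mult_ac)
  have "of_real w' * (\<i> * z) * (of_real ((cn a)\<^sup>2 - (\<beta> a)\<^sup>2) / (M * M)) = \<i> * of_real h * (T / M)"
    using key M0 by (simp add: field_simps)
  moreover have "N (cis (\<omega> v)) = T / M" by (simp add: N_def T_def M_def z_def)
  ultimately have "N (cis (\<omega> v)) * (of_real (- h) * (\<i> * E)) +
      of_real w' * (\<i> * z) * (of_real ((cn a)\<^sup>2 - (\<beta> a)\<^sup>2) / (M * M)) * E = 0"
    by (simp add: algebra_simps)
  then show ?thesis
    using has_vector_derivative_mult[OF dN dE] by (simp add: E_def)
qed

text \<open>
  By the preceding lemma the quotient of both sides is constant in \<open>v\<close>. At \<open>v = 0\<close> it is evaluated
  from \<open>cis (A a) = (cn a + \<i> sn a) (dn a + \<i> k sn a)\<close>, by algebra alone.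
\<close>

lemma factor_on_arc:
  assumes "0 < sn a"
  shows "(of_real (cn a) * cis (\<omega> v) - \<i> * of_real (\<beta> a)) / (of_real (cn a) + \<i> * of_real (\<beta> a) * cis (\<omega> v))
    = - \<i> * cis ((A (v - a) - A (v + a)) / 2)"
proof -
  let ?N = "\<lambda>z. (of_real (cn a) * z - \<i> * of_real (\<beta> a)) / (of_real (cn a) + \<i> * of_real (\<beta> a) * z)"
  let ?H = "\<lambda>v. ?N (cis (\<omega> v)) * cis (- ((A (v - a) - A (v + a)) / 2))"
  obtain c where c: "\<And>v. ?H v = c"
    by (rule has_vector_derivative_zero_constant[OF convex_UNIV factor_on_arc_deriv[OF assms]]) simp
  have const: "?H v = ?H 0" by (simp only: c)
  have z0: "cis (\<omega> 0) = of_real kc + \<i> * of_real k"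
    using cos_\<omega>[of 0] sin_\<omega>[of 0] by (simp add: complex_eq_iff)
  have "(of_real (cn a) * cis (\<omega> 0) - \<i> * of_real (\<beta> a)) * cis (A a)
      = - \<i> * (of_real (cn a) + \<i> * of_real (\<beta> a) * cis (\<omega> 0))"
  proof -
    define c s d \<kappa> \<k> :: complex where defs: "c = cn a" "s = sn a" "d = dn a" "\<kappa> = kc" "\<k> = k"
    have "c\<^sup>2 + s\<^sup>2 = of_real ((cn a)\<^sup>2 + (sn a)\<^sup>2)" by (simp add: defs)
    then have cs: "c\<^sup>2 + s\<^sup>2 = 1" by (simp add: cn_sq)
    have "d\<^sup>2 = of_real ((dn a)\<^sup>2)" by (simp add: defs)
    then have ds: "d\<^sup>2 = 1 - \<k>\<^sup>2 * s\<^sup>2" unfolding dn_sq by (simp add: defs)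
    have "\<kappa>\<^sup>2 = of_real (kc\<^sup>2)" by (simp add: defs)
    then have ks: "\<kappa>\<^sup>2 = 1 - \<k>\<^sup>2" unfolding kc_sq by (simp add: defs)
    have "(c * (\<kappa> + \<i> * \<k>) - \<i> * (\<kappa> * s + d)) * ((c + \<i> * s) * (d + \<i> * (\<k> * s)))
      = - \<i> * (c + \<i> * (\<kappa> * s + d) * (\<kappa> + \<i> * \<k>))"
      using cs ds ks i_squared by algebra
    then show ?thesis by (simp add: z0 cis_A \<beta>_def defs)
  qed
  then have "?H 0 = - \<i>"
    using factor_denominator_nonzero[OF assms, of "cis (\<omega> 0)"] by simp
  then have "?N (cis (\<omega> v)) * cis (- ((A (v - a) - A (v + a)) / 2)) * cis ((A (v - a) - A (v + a)) / 2)
      = - \<i> * cis ((A (v - a) - A (v + a)) / 2)"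
    unfolding const by simp
  then show ?thesis by (simp add: mult.assoc cis_mult)
qed

end

section \<open>The phase on the arc\<close>

text \<open>
  The last term outweighs the alternating sum of the preceding ones, which is at most the term before it.
\<close>

lemma alternating_sum_bounds:
  fixes x :: "nat \<Rightarrow> real"
  assumes "0 < n" "\<And>i j. 1 \<le> i \<Longrightarrow> i < j \<Longrightarrow> x i < x j" "0 < x 1"
  shows "0 < (-1) ^ n * (\<Sum>j=1..n. (-1) ^ j * x j) \<and> (-1) ^ n * (\<Sum>j=1..n. (-1) ^ j * x j) \<le> x n"
  using assms(1)
proof (induction n rule: nat_induct_non_zero)
  case 1
  show ?case using assms(3) by simp
next
  case (Suc n)
  have "(-1) ^ Suc n * (\<Sum>j=1..Suc n. (-1) ^ j * x j) = x (Suc n) - (-1) ^ n * (\<Sum>j=1..n. (-1) ^ j * x j)"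
    by (simp add: algebra_simps flip: power_add mult_2)
  moreover have "x n < x (Suc n)" using Suc.hyps by (intro assms(2)) auto
  ultimately show ?case using Suc.IH by linarith
qed

lemma alternating_telescope:
  fixes x :: "nat \<Rightarrow> real"
  shows "(\<Sum>i<n. (-1) ^ i * (x i + x (Suc i))) = x 0 - (-1) ^ n * x n"
  by (induction n) (auto simp: algebra_simps)

context elliptic_modulus begin

definition node :: "nat \<Rightarrow> nat \<Rightarrow> real" where "node m j = (2 * real j - 1) / real m * K"

text \<open>
  The argument of \<open>s\<^sub>m\<close> at \<open>cis (\<omega> v)\<close>: see \<open>PQ_on_arc\<close>. Its constant term is the argument of
  \<open>\<i> (- \<i>)\<^sup>m (- \<i>)\<^sup>m\<close>, from the constant of \<open>s\<^sub>m\<close> and from the \<open>m\<close> factors.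
\<close>

definition phase :: "nat \<Rightarrow> real \<Rightarrow> real" where
  "phase m v = (-1) ^ m * (pi / 2) + (\<Sum>j=1..m. (-1) ^ j * ((A (v - node m j) - A (v + node m j)) / 2))"

lemma node_bounds: "1 \<le> j \<Longrightarrow> j \<le> m \<Longrightarrow> 0 < node m j \<and> node m j < 2 * K"
  using K_pos by (auto simp: node_def divide_less_eq)

lemma node_less: "0 < m \<Longrightarrow> i < j \<Longrightarrow> node m i < node m j"
  using K_pos by (simp add: node_def divide_strict_right_mono)

lemma node_Suc: "node m (Suc j) = node m j + 2 * K / m"
  by (simp add: node_def diff_divide_distrib add_divide_distrib algebra_simps)

lemma node_reflect: "j \<le> m \<Longrightarrow> 0 < m \<Longrightarrow> node m (m + 1 - j) = 2 * K - node m j"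
  by (simp add: node_def of_nat_diff field_simps)

text \<open>
  The arguments \<open>v - a\<^sub>j\<close> and \<open>v + a\<^sub>j\<close> form an arithmetic progression of step \<open>2 K / m\<close> and length \<open>4 K\<close>, with
  alternating signs. The shift moves each term to its neighbour, so the sum of the two phases
  telescopes; \<open>A (x + 4 K) = A x + 2 \<pi>\<close> accounts for the two ends.
\<close>

lemma phase_shift:
  assumes "0 < m"
  shows "phase m (v + 2 * K / m) = - phase m v"
proof -
  define f where "f i = A (v - node m i)" for i
  define g where "g i = A (v + node m i)" for i
  have shift: "(\<Sum>j=1..m. (-1) ^ j * c j) = (\<Sum>i<m. (-1) ^ Suc i * c (Suc i))" for c :: "nat \<Rightarrow> real"
    using sum.shift_bounds_Suc_ivl[of "\<lambda>j. (-1) ^ j * c j" 0 m]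
    by (simp add: atLeastLessThanSuc_atLeastAtMost lessThan_atLeast0)
  have p0: "phase m v = (-1) ^ m * (pi / 2) + (\<Sum>i<m. (-1) ^ Suc i * ((f (Suc i) - g (Suc i)) / 2))"
    unfolding phase_def shift by (simp add: f_def g_def)
  have p1: "phase m (v + 2 * K / m) = (-1) ^ m * (pi / 2) + (\<Sum>i<m. (-1) ^ Suc i * ((f i - g (Suc (Suc i))) / 2))"
  proof -
    have "A (v + 2 * K / m - node m (Suc i)) = f i" "A (v + 2 * K / m + node m (Suc i)) = g (Suc (Suc i))" for i
      by (simp_all add: f_def g_def node_Suc algebra_simps)
    then show ?thesis unfolding phase_def shift by simp
  qed
  have "(\<Sum>i<m. (-1) ^ Suc i * ((f i - g (Suc (Suc i))) / 2)) + (\<Sum>i<m. (-1) ^ Suc i * ((f (Suc i) - g (Suc i)) / 2))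
      = (\<Sum>i<m. (-1) ^ i * (g (Suc i) + g (Suc (Suc i)))) / 2 - (\<Sum>i<m. (-1) ^ i * (f i + f (Suc i))) / 2"
    unfolding sum_divide_distrib sum.distrib[symmetric] sum_subtractf[symmetric]
    by (intro sum.cong) (auto simp: field_simps)
  also have "\<dots> = ((g 1 - f 0) + (-1) ^ m * (f m - g (Suc m))) / 2"
    using alternating_telescope[of f m] alternating_telescope[of "\<lambda>i. g (Suc i)" m]
    by (simp add: field_simps)
  also have "g 1 = f 0" using assms by (simp add: f_def g_def node_def)
  also have "g (Suc m) = f m + 2 * pi"
  proof -
    have "v + node m (Suc m) = v - node m m + 4 * K"
      using assms by (simp add: node_def field_simps)
    then show ?thesis by (simp only: f_def g_def A_add_4K)
  qed
  finally show ?thesis unfolding p0 p1 by (simp add: algebra_simps)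
qed

lemma A_shift_deriv: "((\<lambda>v. A (v + c)) has_real_derivative dn (v + c) + k * cn (v + c)) (at v)"
proof -
  have "((\<lambda>v. v + c) has_real_derivative 1) (at v)" by (auto intro!: derivative_eq_intros)
  from DERIV_chain2[where f = A and g = "\<lambda>v. v + c", OF A_deriv this] show ?thesis by simp
qed

lemma phase_deriv: "\<exists>d. (phase m has_real_derivative d) (at v)"
proof -
  define d where "d a = ((dn (v + - a) + k * cn (v + - a)) - (dn (v + a) + k * cn (v + a))) / 2" for a
  have "((\<lambda>v. (A (v - a) - A (v + a)) / 2) has_real_derivative d a) (at v)" for a
    using DERIV_cdivide[OF DERIV_diff[OF A_shift_deriv[of "- a"] A_shift_deriv[of a]], where x = v and c = 2]
    by (simp add: d_def)
  then have "(phase m has_real_derivative 0 + (\<Sum>j=1..m. (-1) ^ j * d (node m j))) (at v)"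
    unfolding phase_def[abs_def] by (intro DERIV_add DERIV_const DERIV_sum DERIV_cmult)
  then show ?thesis by (rule exI)
qed

text \<open>
  At \<open>v = 0\<close> the phase is an alternating sum of the increasing values \<open>A a\<^sub>j\<close>, which lie between
  \<open>A 0 = 0\<close> and \<open>A (2 K) = \<pi>\<close>.
\<close>

lemma phase_0_bound:
  assumes "0 < m" shows "\<bar>phase m 0\<bar> < pi / 2"
proof -
  define S where "S = (-1) ^ m * (\<Sum>j=1..m. (-1) ^ j * A (node m j))"
  have pos: "0 < node m j" if "1 \<le> j" "j \<le> m" for j using node_bounds that by blast
  have "0 < S \<and> S \<le> A (node m m)"
    unfolding S_def using assms A_strict_mono[of 0 "node m 1"] node_bounds[of 1 m]
    by (intro alternating_sum_bounds A_strict_mono node_less) auto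
  moreover have "A (node m m) < pi"
    using A_strict_mono[of "node m m" "2 * K"] node_bounds[of m m] assms by (simp add: A_2K)
  moreover have "(-1) ^ m * phase m 0 = pi / 2 - S"
    by (simp add: phase_def S_def algebra_simps sum_negf flip: power_add mult_2)
  ultimately have "\<bar>(-1) ^ m * phase m 0\<bar> < pi / 2" by linarith
  then show ?thesis by (simp add: abs_mult)
qed

end

section \<open>Products of linear fractional factors as quotients of polynomials\<close>

text \<open>
  The product of the factors \<open>(\<alpha> w - \<i> \<gamma>) / (\<alpha> + \<i> \<gamma> w)\<close> at \<open>w = p / q\<close>, with denominators cleared.
  Homogeneous coefficients \<open>(\<alpha>, \<gamma>)\<close> instead of \<open>b = \<gamma> / \<alpha>\<close> include \<open>b = \<infinity>\<close>, and general \<open>p\<close>, \<open>q\<close>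
  include the composite.
\<close>

definition zol_num :: "nat \<Rightarrow> (nat \<Rightarrow> real) \<Rightarrow> (nat \<Rightarrow> real) \<Rightarrow> complex poly \<Rightarrow> complex poly \<Rightarrow> complex poly" where
  "zol_num m \<alpha> \<gamma> p q = smult (\<i> * (- \<i>) ^ m)
     (\<Prod>j=1..m. smult (of_real (\<alpha> j)) p - smult (\<i> * of_real (\<gamma> j)) q)"

definition zol_den :: "nat \<Rightarrow> (nat \<Rightarrow> real) \<Rightarrow> (nat \<Rightarrow> real) \<Rightarrow> complex poly \<Rightarrow> complex poly \<Rightarrow> complex poly" where
  "zol_den m \<alpha> \<gamma> p q = (\<Prod>j=1..m. smult (of_real (\<alpha> j)) q + smult (\<i> * of_real (\<gamma> j)) p)"

lemma i_powi: "\<i> powi (1 - int m) = \<i> * (- \<i>) ^ m"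
  by (simp add: power_int_diff power_int_of_nat divide_inverse flip: power_inverse)

lemma poly_zol_num: "poly (zol_num m \<alpha> \<gamma> p q) z = \<i> * (- \<i>) ^ m *
    (\<Prod>j=1..m. of_real (\<alpha> j) * poly p z - \<i> * of_real (\<gamma> j) * poly q z)"
  by (simp add: zol_num_def poly_prod)

lemma poly_zol_den: "poly (zol_den m \<alpha> \<gamma> p q) z =
    (\<Prod>j=1..m. of_real (\<alpha> j) * poly q z + \<i> * of_real (\<gamma> j) * poly p z)"
  by (simp add: zol_den_def poly_prod)

lemma degree_prod_le:
  assumes "\<And>j. j \<in> I \<Longrightarrow> degree (f j) \<le> d"
  shows "degree (\<Prod>j\<in>I. f j) \<le> card I * d"
  using assms
proof (induction I rule: infinite_finite_induct)
  case (insert x F)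
  have "degree (\<Prod>j\<in>insert x F. f j) \<le> degree (f x) + degree (prod f F)"
    using insert by (simp add: degree_mult_le)
  also have "\<dots> \<le> d + card F * d" using insert by (intro add_mono) auto
  finally show ?case using insert by simp
qed auto

lemma degree_zol_num: "degree p \<le> d \<Longrightarrow> degree q \<le> d \<Longrightarrow> degree (zol_num m \<alpha> \<gamma> p q) \<le> m * d"
  unfolding zol_num_def
  using degree_prod_le[of "{1..m}" "\<lambda>j. smult (of_real (\<alpha> j)) p - smult (\<i> * of_real (\<gamma> j)) q" d]
  by (force intro!: degree_diff_le order_trans[OF degree_smult_le])

lemma degree_zol_den: "degree p \<le> d \<Longrightarrow> degree q \<le> d \<Longrightarrow> degree (zol_den m \<alpha> \<gamma> p q) \<le> m * d"
  unfolding zol_den_def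
  using degree_prod_le[of "{1..m}" "\<lambda>j. smult (of_real (\<alpha> j)) q + smult (\<i> * of_real (\<gamma> j)) p" d]
  by (force intro!: degree_add_le order_trans[OF degree_smult_le])

text \<open>
  That is, \<open>p / q\<close> commutes with the reflection \<open>z \<mapsto> - cnj z\<close> in the imaginary axis.
\<close>

definition mirror_symmetric :: "complex poly \<Rightarrow> complex poly \<Rightarrow> bool" where
  "mirror_symmetric p q \<longleftrightarrow>
     (\<forall>z. poly p (- cnj z) = - cnj (poly p z) \<and> poly q (- cnj z) = cnj (poly q z))"

lemma mirror_symmetric_zol:
  assumes "mirror_symmetric p q"
  shows "mirror_symmetric (zol_num m \<alpha> \<gamma> p q) (zol_den m \<alpha> \<gamma> p q)"
proof -
  have p: "poly p (- cnj z) = - cnj (poly p z)" and q: "poly q (- cnj z) = cnj (poly q z)" for z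
    using assms by (auto simp: mirror_symmetric_def)
  have "poly (zol_num m \<alpha> \<gamma> p q) (- cnj z) = - cnj (poly (zol_num m \<alpha> \<gamma> p q) z)" for z
  proof -
    have "(\<Prod>j=1..m. of_real (\<alpha> j) * poly p (- cnj z) - \<i> * of_real (\<gamma> j) * poly q (- cnj z))
        = (\<Prod>j=1..m. (- 1) * cnj (of_real (\<alpha> j) * poly p z - \<i> * of_real (\<gamma> j) * poly q z))"
      by (intro prod.cong) (auto simp: p q)
    also have "\<dots> = (- 1) ^ m * cnj (\<Prod>j=1..m. of_real (\<alpha> j) * poly p z - \<i> * of_real (\<gamma> j) * poly q z)"
      by (simp only: prod.distrib prod_constant cnj_prod) simp
    finally have e: "poly (zol_num m \<alpha> \<gamma> p q) (- cnj z) = \<i> * ((- \<i>) ^ m * (- 1) ^ m)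
        * cnj (\<Prod>j=1..m. of_real (\<alpha> j) * poly p z - \<i> * of_real (\<gamma> j) * poly q z)"
      unfolding poly_zol_num by (simp only: mult.assoc)
    have "(- \<i>) ^ m * (- 1) ^ m = \<i> ^ m" by (simp flip: power_mult_distrib)
    then show ?thesis
      unfolding e unfolding poly_zol_num by simp
  qed
  moreover have "poly (zol_den m \<alpha> \<gamma> p q) (- cnj z) = cnj (poly (zol_den m \<alpha> \<gamma> p q) z)" for z
    unfolding poly_zol_den cnj_prod by (intro prod.cong) (auto simp: p q)
  ultimately show ?thesis by (simp add: mirror_symmetric_def)
qed

lemma mirror_symmetric_id: "mirror_symmetric [:0, 1:] 1"
  by (simp add: mirror_symmetric_def)

lemma
  assumes "poly q z \<noteq> 0"
  shows poly_zol_num_homogeneous: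
      "poly (zol_num m \<alpha> \<gamma> p q) z = poly q z ^ m * poly (zol_num m \<alpha> \<gamma> [:0, 1:] 1) (poly p z / poly q z)"
    and poly_zol_den_homogeneous:
      "poly (zol_den m \<alpha> \<gamma> p q) z = poly q z ^ m * poly (zol_den m \<alpha> \<gamma> [:0, 1:] 1) (poly p z / poly q z)"
proof -
  have "(\<Prod>j=1..m. of_real (\<alpha> j) * poly p z - \<i> * of_real (\<gamma> j) * poly q z)
      = (\<Prod>j=1..m. poly q z * (of_real (\<alpha> j) * (poly p z / poly q z) - \<i> * of_real (\<gamma> j)))"
    using assms by (intro prod.cong) (auto simp: field_simps)
  then show "poly (zol_num m \<alpha> \<gamma> p q) z = poly q z ^ m * poly (zol_num m \<alpha> \<gamma> [:0, 1:] 1) (poly p z / poly q z)"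
    by (simp add: poly_zol_num prod.distrib)
  have "(\<Prod>j=1..m. of_real (\<alpha> j) * poly q z + \<i> * of_real (\<gamma> j) * poly p z)
      = (\<Prod>j=1..m. poly q z * (of_real (\<alpha> j) + \<i> * of_real (\<gamma> j) * (poly p z / poly q z)))"
    using assms by (intro prod.cong) (auto simp: field_simps)
  then show "poly (zol_den m \<alpha> \<gamma> p q) z = poly q z ^ m * poly (zol_den m \<alpha> \<gamma> [:0, 1:] 1) (poly p z / poly q z)"
    by (simp add: poly_zol_den prod.distrib)
qed

lemma cmod_linear_factor:
  assumes "cmod z = 1"
  shows "cmod (of_real a * z - \<i> * of_real b) = cmod (of_real a + \<i> * of_real b * z)"
proof -
  have "z * cnj z = 1" using assms by (simp flip: complex_norm_square)
  then have "z * (\<i> * of_real b * cnj z) = \<i> * of_real b"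
    by (metis mult.left_commute mult.right_neutral)
  then have "of_real a * z - \<i> * of_real b = z * cnj (of_real a + \<i> * of_real b * z)"
    by (simp add: algebra_simps)
  then have "cmod (of_real a * z - \<i> * of_real b) = cmod z * cmod (cnj (of_real a + \<i> * of_real b * z))"
    by (simp only: norm_mult)
  then show ?thesis by (simp only: assms complex_mod_cnj mult_1_left)
qed

lemma linear_factor_nonzero:
  assumes "cmod z = 1" "\<bar>a\<bar> \<noteq> \<bar>b\<bar>"
  shows "of_real a + \<i> * of_real b * z \<noteq> 0"
proof
  assume "of_real a + \<i> * of_real b * z = 0"
  then have "cmod (of_real a) = cmod (\<i> * of_real b * z)"
    by (metis add_eq_0_iff2 norm_minus_cancel)
  then show False using assms by (simp add: norm_mult)
qed

lemma
  assumes "cmod z = 1" "\<And>j. 1 \<le> j \<Longrightarrow> j \<le> m \<Longrightarrow> \<bar>\<alpha> j\<bar> \<noteq> \<bar>\<gamma> j\<bar>"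
  shows zol_den_nonzero: "poly (zol_den m \<alpha> \<gamma> [:0, 1:] 1) z \<noteq> 0"
    and cmod_zol: "cmod (poly (zol_num m \<alpha> \<gamma> [:0, 1:] 1) z / poly (zol_den m \<alpha> \<gamma> [:0, 1:] 1) z) = 1"
proof -
  show nz: "poly (zol_den m \<alpha> \<gamma> [:0, 1:] 1) z \<noteq> 0"
    using linear_factor_nonzero[OF assms(1)] assms(2) by (auto simp: poly_zol_den)
  have "cmod (poly (zol_num m \<alpha> \<gamma> [:0, 1:] 1) z) = cmod (poly (zol_den m \<alpha> \<gamma> [:0, 1:] 1) z)"
    using cmod_linear_factor[OF assms(1)] by (simp add: poly_zol_num poly_zol_den norm_mult norm_power prod_norm[symmetric])
  then show "cmod (poly (zol_num m \<alpha> \<gamma> [:0, 1:] 1) z / poly (zol_den m \<alpha> \<gamma> [:0, 1:] 1) z) = 1"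
    using nz by (simp add: norm_divide)
qed

lemma prod_mult_cis: "(\<Prod>j=1..m. c * cis (f j)) = c ^ m * cis (\<Sum>j=1..m. f j)"
  by (induction m) (auto simp: cis_mult[symmetric])

lemma zol_factor_ereal:
  assumes "a \<noteq> 0"
  shows "zol_factor (ereal (b / a)) z =
    (of_real a * z - \<i> * of_real b) / (of_real a + \<i> * of_real b * z)"
proof -
  have "of_real a * z - \<i> * of_real b = of_real a * (z - \<i> * of_real (b / a))"
    and "of_real a + \<i> * of_real b * z = of_real a * (1 + \<i> * of_real (b / a) * z)"
    using assms by (auto simp: field_simps)
  then show ?thesis using assms by (simp add: zol_factor_def)
qed

text \<open>
  Each factor maps \<open>\<i>\<close> to \<open>\<i>\<close>, and the constant is \<open>\<i>\<close> to the power \<open>1 - m\<close>.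
\<close>

lemma zol_at_i: "poly (zol_num m \<alpha> \<gamma> [:0, 1:] 1) \<i> = \<i> * poly (zol_den m \<alpha> \<gamma> [:0, 1:] 1) \<i>"
proof -
  have "(\<Prod>j=1..m. of_real (\<alpha> j) * \<i> - \<i> * of_real (\<gamma> j)) = (\<Prod>j=1..m. \<i> * (of_real (\<alpha> j) - of_real (\<gamma> j)))"
    by (intro prod.cong) (auto simp: algebra_simps)
  moreover have "(- \<i>) ^ m * \<i> ^ m = 1" by (simp flip: power_mult_distrib)
  moreover have "\<i> * of_real x * \<i> = - of_real x" for x by (simp add: complex_eq_iff)
  ultimately show ?thesis
    by (simp add: poly_zol_num poly_zol_den prod.distrib flip: mult.assoc)
qed

context elliptic_modulus begin

text \<open>
  For odd \<open>m\<close> the coefficients with odd index carry a minus sign. It is absorbed by replacing \<open>a\<close> by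
  \<open>2 K - a\<close>, which negates \<open>cn\<close> and keeps \<open>\<beta>\<close>; this reflection permutes the odd indices.
\<close>

definition paired_node :: "nat \<Rightarrow> nat \<Rightarrow> real" where
  "paired_node m j = node m (if odd m \<and> odd j then m + 1 - j else j)"

definition \<alpha>\<^sub>z :: "nat \<Rightarrow> nat \<Rightarrow> real" where
  "\<alpha>\<^sub>z m j = (if even j then cn (paired_node m j) else \<beta> (paired_node m j))"

definition \<gamma>\<^sub>z :: "nat \<Rightarrow> nat \<Rightarrow> real" where
  "\<gamma>\<^sub>z m j = (if even j then \<beta> (paired_node m j) else cn (paired_node m j))"

abbreviation P :: "nat \<Rightarrow> complex poly" where "P m \<equiv> zol_num m (\<alpha>\<^sub>z m) (\<gamma>\<^sub>z m) [:0, 1:] 1"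
abbreviation Q :: "nat \<Rightarrow> complex poly" where "Q m \<equiv> zol_den m (\<alpha>\<^sub>z m) (\<gamma>\<^sub>z m) [:0, 1:] 1"

lemma paired_node_bounds:
  assumes "1 \<le> j" "j \<le> m" shows "0 < paired_node m j \<and> paired_node m j < 2 * K"
  unfolding paired_node_def using assms by (intro node_bounds) auto

lemma sn_paired_node: "1 \<le> j \<Longrightarrow> j \<le> m \<Longrightarrow> 0 < sn (paired_node m j)"
  using paired_node_bounds sn_pos by blast

lemma abs_\<alpha>_\<gamma>:
  assumes "1 \<le> j" "j \<le> m"
  shows "even j \<Longrightarrow> \<bar>\<alpha>\<^sub>z m j\<bar> < \<gamma>\<^sub>z m j" "odd j \<Longrightarrow> \<bar>\<gamma>\<^sub>z m j\<bar> < \<alpha>\<^sub>z m j"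
  using abs_cn_less_\<beta>[OF sn_paired_node[OF assms]] by (auto simp: \<alpha>\<^sub>z_def \<gamma>\<^sub>z_def)

lemma abs_\<alpha>_neq_\<gamma>: "1 \<le> j \<Longrightarrow> j \<le> m \<Longrightarrow> \<bar>\<alpha>\<^sub>z m j\<bar> \<noteq> \<bar>\<gamma>\<^sub>z m j\<bar>"
  using abs_\<alpha>_\<gamma>[of j m] by (cases "even j") auto

lemma Q_nonzero: "cmod z = 1 \<Longrightarrow> poly (Q m) z \<noteq> 0"
  using abs_\<alpha>_neq_\<gamma> by (intro zol_den_nonzero) auto

lemma cmod_PQ: "cmod z = 1 \<Longrightarrow> cmod (poly (P m) z / poly (Q m) z) = 1"
  using abs_\<alpha>_neq_\<gamma> by (intro cmod_zol) auto

text \<open>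
  For odd \<open>j\<close> the coefficient is inverted, which turns a factor \<open>g\<close> into \<open>- 1 / g\<close>.
\<close>

lemma factor_on_arc_signed:
  assumes "1 \<le> j" "j \<le> m"
  shows "(of_real (\<alpha>\<^sub>z m j) * cis (\<omega> v) - \<i> * of_real (\<gamma>\<^sub>z m j)) / (of_real (\<alpha>\<^sub>z m j) + \<i> * of_real (\<gamma>\<^sub>z m j) * cis (\<omega> v))
     = - \<i> * cis ((-1) ^ j * ((A (v - paired_node m j) - A (v + paired_node m j)) / 2))"
proof (cases "even j")
  case True
  then show ?thesis using factor_on_arc[OF sn_paired_node[OF assms], of v] by (simp add: \<alpha>\<^sub>z_def \<gamma>\<^sub>z_def)
next
  case False
  define a where "a = paired_node m j"
  define h where "h = (A (v - a) - A (v + a)) / 2"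
  define x where "x = of_real (cn a) * cis (\<omega> v) - \<i> * of_real (\<beta> a)"
  define y where "y = of_real (cn a) + \<i> * of_real (\<beta> a) * cis (\<omega> v)"
  have xy: "x / y = - \<i> * cis h"
    using factor_on_arc[OF sn_paired_node[OF assms], of v] by (simp add: x_def y_def h_def a_def)
  have "of_real (\<beta> a) * cis (\<omega> v) - \<i> * of_real (cn a) = - \<i> * y" by (simp add: y_def algebra_simps)
  moreover have "of_real (\<beta> a) + \<i> * of_real (cn a) * cis (\<omega> v) = \<i> * x" by (simp add: x_def algebra_simps)
  moreover have "(- \<i> * y) / (\<i> * x) = - inverse (x / y)" by simp
  moreover have "\<dots> = - \<i> * cis (- h)" unfolding xy by (simp add: complex_eq_iff)
  moreover have "- h = (-1) ^ j * ((A (v - a) - A (v + a)) / 2)"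
    using False by (simp add: h_def minus_divide_left)
  ultimately show ?thesis
    using False by (simp only: \<alpha>\<^sub>z_def \<gamma>\<^sub>z_def a_def if_False)
qed

lemma PQ_on_arc:
  shows "poly (P m) (cis (\<omega> v)) / poly (Q m) (cis (\<omega> v)) = cis (phase m v)"
proof -
  let ?h = "\<lambda>a. (A (v - a) - A (v + a)) / 2"
  let ?r = "\<lambda>j. if odd m \<and> odd j then m + 1 - j else j"
  have "bij_betw ?r {1..m} {1..m}"
    by (rule bij_betw_byWitness[of _ ?r]) (auto simp: even_diff_nat)
  then have "(\<Prod>j=1..m. - \<i> * cis ((-1) ^ (?r j) * ?h (node m (?r j)))) = (\<Prod>j=1..m. - \<i> * cis ((-1) ^ j * ?h (node m j)))"
    by (rule prod.reindex_bij_betw)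
  moreover have "(\<Prod>j=1..m. - \<i> * cis ((-1) ^ j * ?h (paired_node m j)))
      = (\<Prod>j=1..m. - \<i> * cis ((-1) ^ (?r j) * ?h (node m (?r j))))"
  proof (intro prod.cong refl)
    fix j assume "j \<in> {1..m}"
    then have "(- 1 :: real) ^ (?r j) = (- 1) ^ j"
      by (auto simp: minus_one_power_iff even_diff_nat)
    then show "- \<i> * cis ((-1) ^ j * ?h (paired_node m j)) = - \<i> * cis ((-1) ^ (?r j) * ?h (node m (?r j)))"
      by (simp only: paired_node_def)
  qed
  ultimately have reorder: "(\<Prod>j=1..m. - \<i> * cis ((-1) ^ j * ?h (paired_node m j)))
      = (\<Prod>j=1..m. - \<i> * cis ((-1) ^ j * ?h (node m j)))" by simp
  have sign: "\<i> * (- \<i>) ^ m * (- \<i>) ^ m = cis ((- 1) ^ m * (pi / 2))"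
  proof -
    have "(- \<i>) ^ m * (- \<i>) ^ m = (- 1) ^ m" by (simp flip: power_mult_distrib)
    then have "\<i> * (- \<i>) ^ m * (- \<i>) ^ m = \<i> * (- 1) ^ m" by (simp add: mult.assoc)
    then show ?thesis by (cases "even m") (auto simp: complex_eq_iff)
  qed
  have "poly (P m) (cis (\<omega> v)) / poly (Q m) (cis (\<omega> v))
      = \<i> * (- \<i>) ^ m * (\<Prod>j=1..m. - \<i> * cis ((-1) ^ j * ?h (paired_node m j)))"
  proof -
    have "(\<Prod>j=1..m. of_real (\<alpha>\<^sub>z m j) * cis (\<omega> v) - \<i> * of_real (\<gamma>\<^sub>z m j)) /
        (\<Prod>j=1..m. of_real (\<alpha>\<^sub>z m j) + \<i> * of_real (\<gamma>\<^sub>z m j) * cis (\<omega> v))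
      = (\<Prod>j=1..m. - \<i> * cis ((-1) ^ j * ?h (paired_node m j)))"
      unfolding prod_dividef[symmetric] by (intro prod.cong refl factor_on_arc_signed) auto
    then show ?thesis by (simp add: poly_zol_num poly_zol_den flip: times_divide_eq_right)
  qed
  also have "\<dots> = \<i> * (- \<i>) ^ m * ((- \<i>) ^ m * cis (\<Sum>j=1..m. (-1) ^ j * ?h (node m j)))"
    unfolding reorder unfolding prod_mult_cis ..
  also have "\<dots> = cis ((- 1) ^ m * (pi / 2)) * cis (\<Sum>j=1..m. (-1) ^ j * ?h (node m j))"
    using sign by (simp add: mult.assoc)
  also have "\<dots> = cis (phase m v)"
    by (simp only: phase_def cis_mult)
  finally show ?thesis .
qed


text \<open>
  The homogeneous form gives \<open>- 1 / z\<close> for the infinite coefficient, which occurs when \<open>cn\<close> vanishes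
  at a node of even index. Both sides also agree at a pole of the factor, where each of them is a
  division by zero.
\<close>

lemma zol_factor_eq:
  assumes "0 < \<Theta>" "\<Theta> < pi / 2" "k = sin \<Theta>" "1 \<le> j" "j \<le> m"
  shows "zol_factor (zol_b m \<Theta> j) z =
    (of_real (\<alpha>\<^sub>z m j) * z - \<i> * of_real (\<gamma>\<^sub>z m j)) / (of_real (\<alpha>\<^sub>z m j) + \<i> * of_real (\<gamma>\<^sub>z m j) * z)"
proof -
  have cos: "0 < cos \<Theta>" using assms by (intro cos_gt_zero) auto
  have l': "sqrt (1 - (cos \<Theta>)\<^sup>2) = k"
    using k_pos by (simp add: assms(3) flip: sin_squared_eq)
  have "1 - k\<^sup>2 = (cos \<Theta>)\<^sup>2" by (simp add: assms(3) cos_squared_eq)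
  then have l: "cos \<Theta> = kc" using cos by (simp add: kc_def)
  define a where "a = node m j"
  have "0 < sn a" using node_bounds[OF assms(4,5)] sn_pos by (simp add: a_def)
  then have \<beta>: "0 < \<beta> a" by (intro \<beta>_pos) simp
  have b: "zol_b m \<Theta> j = (-1) ^ (m * j) * (ereal (\<beta> a) / ereal (cn a)) powi ((-1) ^ j)"
    unfolding zol_b_def Let_def l' unfolding l \<beta>_def a_def node_def ..
  show ?thesis
  proof (cases "even j")
    case True
    then have ab: "\<alpha>\<^sub>z m j = cn a" "\<gamma>\<^sub>z m j = \<beta> a" by (auto simp: \<alpha>\<^sub>z_def \<gamma>\<^sub>z_def paired_node_def a_def)
    have b1: "zol_b m \<Theta> j = ereal (\<beta> a) / ereal (cn a)" using True by (simp add: b)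
    show ?thesis
    proof (cases "cn a = 0")
      case True
      then have "zol_b m \<Theta> j = \<infinity>" using \<beta> unfolding b1 by (simp add: divide_ereal_def)
      then show ?thesis using True \<beta> by (simp add: zol_factor_def ab)
    next
      case False
      then have "zol_b m \<Theta> j = ereal (\<beta> a / cn a)" by (simp add: b1)
      then show ?thesis using False by (simp only: zol_factor_ereal ab not_False_eq_True)
    qed
  next
    case False
    have "zol_b m \<Theta> j = (-1) ^ m * inverse (ereal (\<beta> a) / ereal (cn a))"
      using False by (simp add: b power_mult power_mult_distrib mult.commute[of m] power_int_minus)
    also have "inverse (ereal (\<beta> a) / ereal (cn a)) = ereal (cn a / \<beta> a)"
      using \<beta> by (cases "cn a = 0") (auto simp: divide_ereal_def divide_inverse mult.commute)
    also have "(-1) ^ m * ereal (cn a / \<beta> a) = ereal ((-1) ^ m * cn a / \<beta> a)"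
      by (cases "even m") auto
    finally have b1: "zol_b m \<Theta> j = ereal ((-1) ^ m * cn a / \<beta> a)" .
    have "\<alpha>\<^sub>z m j = \<beta> a \<and> \<gamma>\<^sub>z m j = (-1) ^ m * cn a"
    proof (cases "even m")
      case True
      then show ?thesis using False by (simp add: \<alpha>\<^sub>z_def \<gamma>\<^sub>z_def paired_node_def a_def)
    next
      case odd: False
      have "paired_node m j = 2 * K - a"
        using False odd node_reflect[of j m] assms(4,5) by (simp add: paired_node_def a_def)
      moreover have "sn (2 * K - a) = sn a" "cn (2 * K - a) = - cn a" "dn (2 * K - a) = dn a"
        using jacobi_add_2K[of "- a"] by simp_all
      ultimately show ?thesis using False odd by (simp add: \<alpha>\<^sub>z_def \<gamma>\<^sub>z_def \<beta>_def)
    qed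
    then show ?thesis using \<beta> b1 zol_factor_ereal[of "\<beta> a" "(-1) ^ m * cn a" z] by simp
  qed
qed

lemma zol_formula_eq:
  assumes "0 < \<Theta>" "\<Theta> < pi / 2" "k = sin \<Theta>"
  shows "zol_formula m \<Theta> z = poly (P m) z / poly (Q m) z"
proof -
  have "(\<Prod>j=1..m. zol_factor (zol_b m \<Theta> j) z) =
    (\<Prod>j=1..m. of_real (\<alpha>\<^sub>z m j) * z - \<i> * of_real (\<gamma>\<^sub>z m j)) /
    (\<Prod>j=1..m. of_real (\<alpha>\<^sub>z m j) + \<i> * of_real (\<gamma>\<^sub>z m j) * z)"
    unfolding prod_dividef[symmetric]
  proof (intro prod.cong refl)
    fix j assume "j \<in> {1..m}"
    then show "zol_factor (zol_b m \<Theta> j) z =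
      (of_real (\<alpha>\<^sub>z m j) * z - \<i> * of_real (\<gamma>\<^sub>z m j)) / (of_real (\<alpha>\<^sub>z m j) + \<i> * of_real (\<gamma>\<^sub>z m j) * z)"
      by (intro zol_factor_eq[OF assms]) auto
  qed
  then show ?thesis by (simp add: zol_formula_def i_powi poly_zol_num poly_zol_den)
qed

text \<open>
  The derivative of \<open>cn / \<beta>\<close> is \<open>- kc / \<beta>\<close>.
\<close>

lemma cn_div_\<beta>_decreasing:
  assumes "0 < a" "a < b" "b < 2 * K"
  shows "cn b / \<beta> b < cn a / \<beta> a"
  using assms(2)
proof (rule DERIV_neg_imp_decreasing)
  fix x assume "a \<le> x" "x \<le> b"
  then have "0 < sn x" using assms by (intro sn_pos) auto
  then have \<beta>: "0 < \<beta> x" by (intro \<beta>_pos) simp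
  have "(\<beta> has_real_derivative kc * (cn x * dn x) + - k\<^sup>2 * sn x * cn x) (at x)"
    unfolding \<beta>_def[abs_def] by (rule DERIV_add[OF DERIV_cmult[OF sn_deriv] dn_deriv])
  from DERIV_divide[OF cn_deriv this] \<beta>
  have "((\<lambda>x. cn x / \<beta> x) has_real_derivative
      (- sn x * dn x * \<beta> x - cn x * (kc * (cn x * dn x) + - k\<^sup>2 * sn x * cn x)) / (\<beta> x * \<beta> x)) (at x)"
    by simp
  moreover have "- sn x * dn x * \<beta> x - cn x * (kc * (cn x * dn x) + - k\<^sup>2 * sn x * cn x) = - kc * \<beta> x"
  proof -
    have "- sn x * dn x * \<beta> x - cn x * (kc * (cn x * dn x) + - k\<^sup>2 * sn x * cn x)
        = - kc * dn x * ((cn x)\<^sup>2 + (sn x)\<^sup>2) - sn x * ((dn x)\<^sup>2 - k\<^sup>2 * (cn x)\<^sup>2)"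
      by (simp add: \<beta>_def algebra_simps power2_eq_square)
    also have "\<dots> = - kc * \<beta> x"
    proof -
      have "(cn x)\<^sup>2 + (sn x)\<^sup>2 = 1" by (simp add: cn_sq)
      then show ?thesis
        by (simp only: dn_sq_minus \<beta>_def) (simp add: algebra_simps power2_eq_square)
    qed
    finally show ?thesis .
  qed
  ultimately have "((\<lambda>x. cn x / \<beta> x) has_real_derivative - kc * \<beta> x / (\<beta> x * \<beta> x)) (at x)" by simp
  moreover have "- kc * \<beta> x / (\<beta> x * \<beta> x) < 0" using \<beta> kc_pos by (simp add: divide_neg_pos)
  ultimately show "\<exists>y. ((\<lambda>x. cn x / \<beta> x) has_real_derivative y) (at x) \<and> y < 0"
    by (intro exI conjI)
qed

text \<open>
  The root belongs to the first factor. It cancels against a factor of \<open>Q\<close> with odd index only if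
  a product of two numbers of modulus below \<open>1\<close> is \<open>1\<close>, and against one with even index only if two nodes of
  different parity coincide.
\<close>

lemma P_root_not_Q_root:
  assumes "0 < m" obtains c where "poly (P m) c = 0" "poly (Q m) c \<noteq> 0"
proof
  have \<alpha>1: "\<bar>\<gamma>\<^sub>z m 1\<bar> < \<alpha>\<^sub>z m 1" using abs_\<alpha>_\<gamma>(2)[of 1 m] assms by simp
  define c where "c = \<i> * of_real (\<gamma>\<^sub>z m 1 / \<alpha>\<^sub>z m 1)"
  show "poly (P m) c = 0"
    unfolding poly_zol_num using assms \<alpha>1 by (auto simp: c_def intro!: bexI[of _ 1])
  show "poly (Q m) c \<noteq> 0"
  proof -
    have "of_real (\<alpha>\<^sub>z m j) + \<i> * of_real (\<gamma>\<^sub>z m j) * c \<noteq> 0" if j: "1 \<le> j" "j \<le> m" for j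
    proof
      assume "of_real (\<alpha>\<^sub>z m j) + \<i> * of_real (\<gamma>\<^sub>z m j) * c = 0"
      moreover have "of_real (\<alpha>\<^sub>z m j) + \<i> * of_real (\<gamma>\<^sub>z m j) * c = of_real (\<alpha>\<^sub>z m j - \<gamma>\<^sub>z m j * (\<gamma>\<^sub>z m 1 / \<alpha>\<^sub>z m 1))"
        by (simp add: c_def complex_eq_iff)
      ultimately have "\<alpha>\<^sub>z m j - \<gamma>\<^sub>z m j * (\<gamma>\<^sub>z m 1 / \<alpha>\<^sub>z m 1) = 0"
        by (metis of_real_eq_0_iff)
      then have eq: "\<alpha>\<^sub>z m j * \<alpha>\<^sub>z m 1 = \<gamma>\<^sub>z m j * \<gamma>\<^sub>z m 1"
        using \<alpha>1 by (simp add: field_simps split: if_splits)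
      show False
      proof (cases "even j")
        case False
        have "\<bar>\<gamma>\<^sub>z m j * \<gamma>\<^sub>z m 1\<bar> < \<bar>\<alpha>\<^sub>z m j * \<alpha>\<^sub>z m 1\<bar>"
          unfolding abs_mult using abs_\<alpha>_\<gamma>(2)[OF j False] \<alpha>1 by (intro abs_mult_less) auto
        then show False using eq by simp
      next
        case True
        define a where "a = paired_node m j"
        define b where "b = paired_node m 1"
        have ab: "0 < a" "a < 2 * K" "0 < b" "b < 2 * K"
          using paired_node_bounds[OF j] paired_node_bounds[of 1 m] assms by (auto simp: a_def b_def)
        then have "0 < \<beta> a" "0 < \<beta> b" by (auto intro!: \<beta>_pos less_imp_le sn_pos)
        moreover have "cn a * \<beta> b = \<beta> a * cn b" using eq True by (simp add: \<alpha>\<^sub>z_def \<gamma>\<^sub>z_def a_def b_def)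
        ultimately have "cn a / \<beta> a = cn b / \<beta> b" by (simp add: field_simps)
        then have "a = b"
          using cn_div_\<beta>_decreasing[of a b] cn_div_\<beta>_decreasing[of b a] ab by (cases a b rule: linorder_cases) auto
        moreover have "j < m + 1 - 1" if "odd m" using True j that by (cases "j = m") auto
        ultimately show False
          using True j node_less[OF assms, of 1 j] node_less[OF assms, of j m]
          by (cases "j = 1"; cases "odd m") (auto simp: a_def b_def paired_node_def)
      qed
    qed
    then show ?thesis by (auto simp: poly_zol_den)
  qed
qed

end

section \<open>Critical points and equioscillation\<close>

lemma sum_order_le_degree:
  fixes p :: "'a :: idom poly"
  assumes "p \<noteq> 0" "finite C"
  shows "(\<Sum>c\<in>C. order c p) \<le> degree p"
proof -
  have "(\<Sum>c\<in>C. order c p) = (\<Sum>c\<in>C. count (proots p) c)" using assms(1) by simp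
  also have "\<dots> = (\<Sum>c\<in>C \<inter> set_mset (proots p). count (proots p) c)"
    by (intro sum.mono_neutral_right) (auto simp: assms order_root)
  also have "\<dots> \<le> (\<Sum>c\<in>set_mset (proots p). count (proots p) c)"
    by (intro sum_mono2) auto
  also have "\<dots> = size (proots p)" by (simp add: size_multiset_overloaded_eq)
  also have "\<dots> \<le> degree p" by (rule size_proots_le)
  finally show ?thesis .
qed

text \<open>
  Differentiate \<open>cnj (W (- cnj z))\<close>, which is holomorphic in \<open>z\<close>.
\<close>

lemma pderiv_mirror:
  fixes W :: "complex poly"
  assumes "\<And>z. poly W (- cnj z) = of_real s * cnj (poly W z)" "s\<^sup>2 = 1"
  shows "poly (pderiv W) (- cnj z) = - of_real s * cnj (poly (pderiv W) z)"
proof -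
  have "((\<lambda>x. poly W (- x)) has_field_derivative - poly (pderiv W) (- cnj z)) (at (cnj z))"
    by (rule derivative_eq_intros poly_DERIV refl | simp)+
  from has_field_derivative_cnj_cnj[OF this]
  have "((\<lambda>z. cnj (poly W (- cnj z))) has_field_derivative cnj (- poly (pderiv W) (- cnj z))) (at z)"
    by (simp add: o_def)
  then have "((\<lambda>z. of_real s * poly W z) has_field_derivative cnj (- poly (pderiv W) (- cnj z))) (at z)"
    by (simp add: assms(1))
  moreover have "((\<lambda>z. of_real s * poly W z) has_field_derivative of_real s * poly (pderiv W) z) (at z)"
    by (intro DERIV_cmult poly_DERIV)
  ultimately have "cnj (- poly (pderiv W) (- cnj z)) = of_real s * poly (pderiv W) z"
    by (rule DERIV_unique)
  then have "- poly (pderiv W) (- cnj z) = cnj (of_real s * poly (pderiv W) z)"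
    by (metis complex_cnj_cnj)
  then have "poly (pderiv W) (- cnj z) = - cnj (of_real s * poly (pderiv W) z)"
    by (metis add.inverse_inverse)
  then show ?thesis by simp
qed

text \<open>
  The numerator of the derivative of \<open>p / q\<close>.
\<close>

definition wronskian :: "complex poly \<Rightarrow> complex poly \<Rightarrow> complex poly" where
  "wronskian p q = pderiv p * q - p * pderiv q"

text \<open>
  At a zero of \<open>p\<close> that is not one of \<open>q\<close>, the two products vanish to different orders.
\<close>

lemma wronskian_nonzero:
  assumes "poly p c = 0" "poly q c \<noteq> 0" "p \<noteq> 0"
  shows "wronskian p q \<noteq> 0"
proof
  assume "wronskian p q = 0"
  then have eq: "pderiv p * q = p * pderiv q" by (simp add: wronskian_def)
  have q0: "q \<noteq> 0" using assms(2) by auto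
  have dp: "pderiv p \<noteq> 0"
  proof
    assume "pderiv p = 0"
    then obtain a where "p = [:a:]" by (auto simp: pderiv_eq_0_iff elim: degree_eq_zeroE)
    then show False using assms by simp
  qed
  from order_pderiv[OF assms(3,1)] have o: "order c p = Suc (order c (pderiv p))" .
  have "pderiv p * q \<noteq> 0" using dp q0 by simp
  then have "order c (pderiv p * q) = order c (pderiv p) + order c q" by (rule order_mult)
  moreover have "order c q = 0" using assms(2) by (simp add: order_root)
  moreover have "order c (p * pderiv q) = order c p + order c (pderiv q)"
    using \<open>pderiv p * q \<noteq> 0\<close> unfolding eq by (rule order_mult)
  ultimately show False using o eq by simp
qed

lemma degree_wronskian:
  assumes "degree p \<le> m" "degree q \<le> m" "0 < m"
  shows "degree (wronskian p q) < 2 * m"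
proof -
  have "degree (pderiv p * q) \<le> (m - 1) + m" "degree (p * pderiv q) \<le> m + (m - 1)"
    using assms by (auto intro!: order_trans[OF degree_mult_le] add_mono simp: degree_pderiv)
  then have "degree (wronskian p q) \<le> m + (m - 1)"
    unfolding wronskian_def by (intro degree_diff_le) auto
  then show ?thesis using assms(3) by simp
qed

lemma wronskian_mirror:
  assumes "mirror_symmetric p q"
  shows "poly (wronskian p q) (- cnj z) = cnj (poly (wronskian p q) z)"
  using pderiv_mirror[of p "- 1" z] pderiv_mirror[of q 1 z] assms
  by (simp add: wronskian_def mirror_symmetric_def)

lemma cell_exists:
  fixes h v :: real
  assumes "0 < n" "0 \<le> v" "v \<le> real n * h"
  shows "\<exists>i<n. real i * h \<le> v \<and> v \<le> real (Suc i) * h"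
  using assms
proof (induction n)
  case (Suc n)
  show ?case
  proof (cases "0 < n \<and> v \<le> real n * h")
    case True
    then show ?thesis using Suc by (meson less_SucI)
  next
    case False
    then have "real n * h \<le> v" using Suc.prems by auto
    then show ?thesis using Suc.prems by (intro exI[of _ n]) auto
  qed
qed simp

context elliptic_modulus begin

lemma Re_cis_\<omega>: "0 < Re (cis (\<omega> v))"
  using kc_pos dn_pos[of v] by (simp add: cos_\<omega>)

lemma \<omega>_strict_antimono:
  assumes "0 \<le> a" "a < b" "b \<le> 2 * K" shows "\<omega> b < \<omega> a"
proof (rule DERIV_neg_imp_decreasing_open[OF assms(2)])
  fix x assume "a < x" "x < b"
  then have "0 < sn x" using assms by (intro sn_pos) auto
  then have "- (k * kc * sn x / dn x) < 0" using k_pos kc_pos dn_pos[of x] by simp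
  then show "\<exists>y. (\<omega> has_real_derivative y) (at x) \<and> y < 0" using \<omega>_deriv[of x] by (intro exI conjI)
next
  show "continuous_on {a..b} \<omega>"
    using \<omega>_deriv by (meson DERIV_isCont continuous_at_imp_continuous_on)
qed

lemma \<omega>_eq_arcsin: "\<omega> v = arcsin (Im (cis (\<omega> v)))"
  unfolding cis.sel sin_\<omega> unfolding \<omega>_def ..

lemma inj_on_cis_\<omega>: "inj_on (\<lambda>v. cis (\<omega> v)) {0..2 * K}"
proof (rule inj_onI)
  fix x y assume xy: "x \<in> {0..2 * K}" "y \<in> {0..2 * K}" "cis (\<omega> x) = cis (\<omega> y)"
  then have "\<omega> x = \<omega> y" using \<omega>_eq_arcsin by metis
  then show "x = y" using \<omega>_strict_antimono[of x y] \<omega>_strict_antimono[of y x] xy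
    by (cases x y rule: linorder_cases) auto
qed

lemma cis_\<omega>_deriv:
  "((\<lambda>v. cis (\<omega> v)) has_vector_derivative of_real (- (k * kc * sn v / dn v)) * (\<i> * cis (\<omega> v))) (at v)"
  by (rule has_vector_derivative_cis[OF \<omega>_deriv])

lemma cis_\<omega>_speed_nonzero:
  "0 < v \<Longrightarrow> v < 2 * K \<Longrightarrow> of_real (- (k * kc * sn v / dn v)) * (\<i> * cis (\<omega> v)) \<noteq> 0"
  using sn_pos[of v] k_pos kc_pos dn_pos[of v] by simp

lemma P_nonzero: "0 < m \<Longrightarrow> P m \<noteq> 0"
  using cmod_PQ[of 1 m] by auto

lemma degree_PQ: "degree (P m) \<le> m" "degree (Q m) \<le> m"
  using degree_zol_num[of "[:0, 1:]" 1 1 m] degree_zol_den[of "[:0, 1:]" 1 1 m] by auto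

lemma wronskian_PQ_nonzero:
  assumes "0 < m" shows "wronskian (P m) (Q m) \<noteq> 0"
proof -
  obtain c where "poly (P m) c = 0" "poly (Q m) c \<noteq> 0" using P_root_not_Q_root[OF assms] .
  then show ?thesis using P_nonzero[OF assms] by (intro wronskian_nonzero)
qed

lemma phase_critical_imp_wronskian_root:
  assumes "(phase m has_real_derivative 0) (at v)" "0 < v" "v < 2 * K"
  shows "poly (wronskian (P m) (Q m)) (cis (\<omega> v)) = 0"
proof -
  let ?z = "cis (\<omega> v)"
  have Q0: "poly (Q m) ?z \<noteq> 0" by (rule Q_nonzero) simp
  have "((\<lambda>z. poly (P m) z / poly (Q m) z) has_field_derivative
      poly (wronskian (P m) (Q m)) ?z / (poly (Q m) ?z * poly (Q m) ?z)) (at ?z)"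
    unfolding wronskian_def poly_diff poly_mult by (rule DERIV_divide[OF poly_DERIV poly_DERIV Q0])
  from field_vector_diff_chain_at[OF cis_\<omega>_deriv this]
  have "((\<lambda>v. cis (phase m v)) has_vector_derivative
      of_real (- (k * kc * sn v / dn v)) * (\<i> * ?z) *
      (poly (wronskian (P m) (Q m)) ?z / (poly (Q m) ?z * poly (Q m) ?z))) (at v)"
    by (simp only: o_def PQ_on_arc)
  moreover have "((\<lambda>v. cis (phase m v)) has_vector_derivative 0) (at v)"
    using has_vector_derivative_cis[OF assms(1)] by simp
  ultimately have "of_real (- (k * kc * sn v / dn v)) * (\<i> * ?z) *
      (poly (wronskian (P m) (Q m)) ?z / (poly (Q m) ?z * poly (Q m) ?z)) = 0"
    by (rule vector_derivative_unique_at)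
  then show ?thesis
    using cis_\<omega>_speed_nonzero[OF assms(2,3)] Q0 by (simp only: mult_eq_0_iff divide_eq_0_iff) auto
qed

lemma phase_shift_nat:
  assumes "0 < m"
  shows "phase m (v + real n * (2 * K / m)) = (-1) ^ n * phase m v"
proof (induction n)
  case (Suc n)
  have "v + real (Suc n) * h = (v + real n * h) + h" for h by (simp add: algebra_simps)
  then have "phase m (v + real (Suc n) * (2 * K / m)) = - phase m (v + real n * (2 * K / m))"
    by (simp only: phase_shift[OF assms])
  then show ?case using Suc by simp
qed simp

lemma phase_deriv_shift:
  assumes "0 < m" "(phase m has_real_derivative d) (at (v + real i * (2 * K / m)))"
  shows "(phase m has_real_derivative (-1) ^ (i + j) * d) (at (v + real j * (2 * K / m)))"
proof -
  define h where "h = 2 * K / m"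
  note shift = phase_shift_nat[OF assms(1), folded h_def]
  have "((\<lambda>x. x + (real i - real j) * h) has_real_derivative 1) (at (v + real j * h))"
    by (auto intro!: derivative_eq_intros)
  moreover have "v + real j * h + (real i - real j) * h = v + real i * h" by (simp add: algebra_simps)
  then have "(phase m has_real_derivative d) (at (v + real j * h + (real i - real j) * h))"
    using assms(2) unfolding h_def[symmetric] by (simp only:)
  ultimately have "((\<lambda>x. phase m (x + (real i - real j) * h)) has_real_derivative d * 1) (at (v + real j * h))"
    by (intro DERIV_chain2[where f = "phase m" and g = "\<lambda>x. x + (real i - real j) * h"])
  from DERIV_cmult[OF this, of "(-1) ^ (i + j)"]
  have "((\<lambda>x. (-1) ^ (i + j) * phase m (x + (real i - real j) * h)) has_real_derivative (-1) ^ (i + j) * d)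
      (at (v + real j * h))" by simp
  moreover have "(-1) ^ (i + j) * phase m (x + (real i - real j) * h) = phase m x" for x
  proof -
    have "phase m (x + (real i - real j) * h) = (-1) ^ i * phase m (x - real j * h)"
      using shift[of "x - real j * h" i] by (simp add: algebra_simps)
    moreover have "phase m x = (-1) ^ j * phase m (x - real j * h)"
      using shift[of "x - real j * h" j] by simp
    ultimately show ?thesis by (simp add: power_add flip: power_mult_distrib)
  qed
  ultimately show ?thesis by (simp add: h_def)
qed

text \<open>
  A critical point inside one cell is repeated by \<open>phase_shift\<close> in every cell and then by reflection
  on the opposite arc. This gives \<open>2 m\<close> zeros of the Wronskian, whose degree is smaller.
\<close>

lemma phase_deriv_nonzero:
  assumes m: "0 < m" and i: "i < m" and v: "real i * (2 * K / m) < v" "v < real (Suc i) * (2 * K / m)"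
    and d: "(phase m has_real_derivative d) (at v)"
  shows "d \<noteq> 0"
proof
  assume "d = 0"
  define h where "h = 2 * K / m"
  note v = v[folded h_def]
  define w where "w j = v - real i * h + real j * h" for j
  have h: "0 < h" using K_pos m by (simp add: h_def)
  have "(phase m has_real_derivative 0) (at (w j))" for j
    using phase_deriv_shift[OF m, folded h_def, of d "v - real i * h" i j] d \<open>d = 0\<close> by (simp add: w_def flip: h_def)
  moreover have w: "0 < w j" "w j < 2 * K" if "j < m" for j
  proof -
    show "0 < w j" using v(1) h by (simp add: w_def add_pos_nonneg)
    have "w j < real (Suc j) * h" using v(2) by (simp add: w_def algebra_simps)
    also have "\<dots> \<le> real m * h" using that h by (intro mult_right_mono) auto
    finally show "w j < 2 * K" using m by (simp add: h_def)
  qed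
  ultimately have root: "poly (wronskian (P m) (Q m)) (cis (\<omega> (w j))) = 0" if "j < m" for j
    using phase_critical_imp_wronskian_root that by blast
  define C where "C = (\<lambda>j. cis (\<omega> (w j))) ` {..<m}"
  have "inj_on (\<lambda>j. cis (\<omega> (w j))) {..<m}"
  proof (rule inj_onI)
    fix i j assume ij: "i \<in> {..<m}" "j \<in> {..<m}" "cis (\<omega> (w i)) = cis (\<omega> (w j))"
    then have "w i = w j"
      using w[of i] w[of j] by (intro inj_onD[OF inj_on_cis_\<omega> ij(3)]) auto
    then show "i = j" using h by (simp add: w_def)
  qed
  then have "card C = m"
    unfolding C_def by (simp add: card_image)
  have "inj_on (\<lambda>z. - cnj z) C" by (auto simp: inj_on_def)
  then have "card ((\<lambda>z. - cnj z) ` C) = m" using \<open>card C = m\<close> card_image by metis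
  moreover have "C \<inter> (\<lambda>z. - cnj z) ` C = {}"
  proof -
    have Re: "0 < Re z" if "z \<in> C" for z using that Re_cis_\<omega> unfolding C_def by blast
    have False if "y \<in> C" "- cnj y \<in> C" for y using Re[OF that(1)] Re[OF that(2)] by simp
    then show ?thesis by blast
  qed
  ultimately have "card (C \<union> (\<lambda>z. - cnj z) ` C) = 2 * m"
    using \<open>card C = m\<close> by (subst card_Un_disjoint) (auto simp: C_def)
  moreover have "C \<union> (\<lambda>z. - cnj z) ` C \<subseteq> {z. poly (wronskian (P m) (Q m)) z = 0}"
    using root wronskian_mirror[OF mirror_symmetric_zol[OF mirror_symmetric_id]] by (auto simp: C_def)
  moreover have "finite {z. poly (wronskian (P m) (Q m)) z = 0}"
    using wronskian_PQ_nonzero[OF m] by (rule poly_roots_finite)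
  ultimately have "2 * m \<le> card {z. poly (wronskian (P m) (Q m)) z = 0}" by (metis card_mono)
  also have "\<dots> \<le> degree (wronskian (P m) (Q m))"
    using wronskian_PQ_nonzero[OF m] by (rule card_poly_roots_bound)
  also have "\<dots> < 2 * m" using degree_PQ m by (intro degree_wronskian)
  finally show False by simp
qed

lemma continuous_phase: "continuous_on S (phase m)"
  using phase_deriv by (meson DERIV_isCont continuous_at_imp_continuous_on)

lemma phase_inj_on_cell:
  assumes "0 < m" "i < m"
  shows "inj_on (phase m) {real i * (2 * K / m)..real (Suc i) * (2 * K / m)}"
proof (rule linorder_inj_onI')
  fix x y assume xy: "x \<in> {real i * (2 * K / m)..real (Suc i) * (2 * K / m)}"
     "y \<in> {real i * (2 * K / m)..real (Suc i) * (2 * K / m)}" "x < y"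
  show "phase m x \<noteq> phase m y"
  proof
    assume "phase m x = phase m y"
    then obtain z where "x < z" "z < y" "(phase m has_real_derivative 0) (at z)"
      using Rolle[OF xy(3) _ continuous_phase] phase_deriv
      by (metis real_differentiable_def)
    then show False using phase_deriv_nonzero[OF assms, of z 0] xy by auto
  qed
qed

lemma phase_node: "0 < m \<Longrightarrow> phase m (real j * (2 * K / m)) = (-1) ^ j * phase m 0"
  using phase_shift_nat[of m 0 j] by simp

lemma phase_between_on_cell:
  assumes "0 < m" "i < m" "real i * (2 * K / m) \<le> x" "x < v" "v < y" "y \<le> real (Suc i) * (2 * K / m)"
  shows "phase m x < phase m v \<and> phase m v < phase m y \<or> phase m y < phase m v \<and> phase m v < phase m x"
  using assms
  by (intro continuous_inj_imp_mono continuous_phase inj_on_subset[OF phase_inj_on_cell[OF assms(1,2)]]) auto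

lemma phase_0_nonzero:
  assumes "0 < m" shows "phase m 0 \<noteq> 0"
proof
  assume "phase m 0 = 0"
  then have "phase m (real 0 * (2 * K / m)) = phase m (real (Suc 0) * (2 * K / m))"
    unfolding phase_node[OF assms] by simp
  then have "real 0 * (2 * K / m) = real (Suc 0) * (2 * K / m)"
    by (rule inj_onD[OF phase_inj_on_cell[OF assms assms]]) (use K_pos in auto)
  then show False using K_pos assms by simp
qed

lemma phase_bound:
  assumes "0 < m" "0 \<le> v" "v \<le> 2 * K"
  shows "\<bar>phase m v\<bar> \<le> \<bar>phase m 0\<bar>"
proof -
  obtain i where i: "i < m" "real i * (2 * K / m) \<le> v" "v \<le> real (Suc i) * (2 * K / m)"
    using cell_exists[of m v "2 * K / m"] assms by auto
  show ?thesis
  proof (cases "v = real i * (2 * K / m) \<or> v = real (Suc i) * (2 * K / m)")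
    case True
    then obtain j where "v = real j * (2 * K / m)" by blast
    then show ?thesis by (simp only: phase_node[OF assms(1)]) (simp add: abs_mult)
  next
    case False
    then have "real i * (2 * K / m) < v" "v < real (Suc i) * (2 * K / m)" using i by auto
    from phase_between_on_cell[OF assms(1) i(1) order.refl this order.refl] show ?thesis
      unfolding phase_node[OF assms(1)] by (cases "even i") auto
  qed
qed

end

section \<open>Comparison with an equioscillating function\<close>

text \<open>
  The multiplicity of a root, capped at two.
\<close>

definition root_mult :: "complex poly \<Rightarrow> complex \<Rightarrow> nat" where
  "root_mult W c = (if poly (pderiv W) c = 0 then 2 else 1)"

lemma root_mult_le_order:
  assumes "W \<noteq> 0" "poly W c = 0"
  shows "root_mult W c \<le> order c W"
proof -
  have o: "order c W = Suc (order c (pderiv W))" by (rule order_pderiv[OF assms])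
  have "pderiv W \<noteq> 0"
  proof
    assume "pderiv W = 0"
    then obtain a where "W = [:a:]" by (auto simp: pderiv_eq_0_iff elim: degree_eq_zeroE)
    then show False using assms by simp
  qed
  then have "order c (pderiv W) \<noteq> 0" if "poly (pderiv W) c = 0" using that by (simp add: order_root)
  then show ?thesis using o by (auto simp: root_mult_def)
qed

text \<open>
  Every root in the right half-plane is reflected to one of the same multiplicity in the left
  half-plane, and \<open>\<i>\<close> lies in neither of them.
\<close>

lemma mirror_roots_exceed_degree:
  fixes W :: "complex poly"
  assumes deg: "degree W \<le> 2 * n"
    and mirror: "\<And>z. poly W (- cnj z) = - cnj (poly W z)"
    and i: "poly W \<i> = 0"
    and C: "finite C" "\<And>c. c \<in> C \<Longrightarrow> 0 < Re c \<and> poly W c = 0"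
    and n: "n \<le> (\<Sum>c\<in>C. root_mult W c)"
  shows "W = 0"
proof (rule ccontr)
  assume W: "W \<noteq> 0"
  let ?\<mu> = "\<lambda>z. - cnj z"
  have d: "poly (pderiv W) (- cnj z) = cnj (poly (pderiv W) z)" for z
    using pderiv_mirror[of W "- 1" z] mirror by simp
  have m: "root_mult W (?\<mu> c) = root_mult W c" for c by (simp add: root_mult_def d)
  have inj: "inj_on ?\<mu> C" by (auto simp: inj_on_def)
  have disj: "C \<inter> ?\<mu> ` C = {}"
  proof -
    have False if "y \<in> C" "- cnj y \<in> C" for y using C(2)[OF that(1)] C(2)[OF that(2)] by simp
    then show ?thesis by blast
  qed
  have ni: "\<i> \<notin> C \<union> ?\<mu> ` C"
  proof
    assume "\<i> \<in> C \<union> ?\<mu> ` C"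
    then obtain c where "c \<in> C" "\<i> = c \<or> \<i> = - cnj c" by blast
    then have "Re c = 0" by (auto simp: complex_eq_iff)
    then show False using C(2)[OF \<open>c \<in> C\<close>] by simp
  qed
  have root: "poly W c = 0" if "c \<in> C \<union> ?\<mu> ` C" for c using that C(2) mirror by auto
  have "2 * n \<le> (\<Sum>c\<in>C. root_mult W c) + (\<Sum>c\<in>?\<mu> ` C. root_mult W c)"
    using n by (simp add: sum.reindex[OF inj] m)
  also have "\<dots> = (\<Sum>c\<in>C \<union> ?\<mu> ` C. root_mult W c)"
    using C(1) disj by (subst sum.union_disjoint) auto
  also have "\<dots> \<le> (\<Sum>c\<in>C \<union> ?\<mu> ` C. order c W)"
    using root by (intro sum_mono root_mult_le_order[OF W])
  also have "\<dots> < (\<Sum>c\<in>insert \<i> (C \<union> ?\<mu> ` C). order c W)"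
    using C(1) ni i W by (simp add: order_root)
  also have "\<dots> \<le> degree W" using C(1) W by (intro sum_order_le_degree) auto
  finally show False using deg by simp
qed

text \<open>
  The imaginary part is extremal, so its derivative vanishes; then \<open>Re\<^sup>2 + Im\<^sup>2 = 1\<close> gives the same
  for the real part.
\<close>

lemma unimodular_extremal_deriv:
  fixes H :: "real \<Rightarrow> complex"
  assumes H: "(H has_vector_derivative H') (at x)" and "\<And>y. cmod (H y) = 1" and "0 < Re (H x)"
    and "0 < e" and ext: "\<And>y. \<bar>x - y\<bar> < e \<Longrightarrow> \<bar>Im (H y)\<bar> \<le> \<bar>Im (H x)\<bar>"
  shows "H' = 0"
proof -
  have Re: "((\<lambda>y. Re (H y)) has_real_derivative Re H') (at x)"
    and Im: "((\<lambda>y. Im (H y)) has_real_derivative Im H') (at x)"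
    using H by (simp_all add: has_vector_derivative_complex_iff)
  have Im0: "Im H' = 0"
  proof (cases "0 \<le> Im (H x)")
    case True
    show ?thesis using ext True
      by (intro DERIV_local_max[OF Im \<open>0 < e\<close>]) force
  next
    case False
    show ?thesis using ext False
      by (intro DERIV_local_min[OF Im \<open>0 < e\<close>]) force
  qed
  have "((\<lambda>y. Re (H y) * Re (H y) + Im (H y) * Im (H y)) has_real_derivative
     (Re H' * Re (H x) + Re H' * Re (H x)) + (Im H' * Im (H x) + Im H' * Im (H x))) (at x)"
    by (intro DERIV_add DERIV_mult Re Im)
  moreover have "Re (H y) * Re (H y) + Im (H y) * Im (H y) = 1" for y
    using assms(2)[of y] by (simp add: cmod_def power2_eq_square)
  ultimately have "((\<lambda>y. 1) has_real_derivative 2 * (Re H' * Re (H x))) (at x)"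
    by (simp add: Im0)
  then have "2 * (Re H' * Re (H x)) = 0" by (rule DERIV_unique) (rule DERIV_const)
  then have "Re H' = 0" using assms(3) by simp
  then show ?thesis using Im0 by (simp add: complex_eq_iff)
qed

lemma unimodular_eqI:
  assumes "cmod x = 1" "cmod y = 1" "0 < Re x" "0 < Re y" "Im x = Im y"
  shows "x = y"
proof -
  have "(Re x)\<^sup>2 = 1 - (Im x)\<^sup>2" "(Re y)\<^sup>2 = 1 - (Im y)\<^sup>2"
    using assms(1,2) by (auto simp: cmod_def)
  then have "(Re x)\<^sup>2 = (Re y)\<^sup>2" using assms(5) by simp
  then have "Re x = Re y" using assms(3,4) by (simp add: power2_eq_iff_nonneg)
  then show ?thesis using assms(5) by (simp add: complex_eq_iff)
qed

lemma abs_sin_eq: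
  fixes x :: real
  assumes "\<bar>x\<bar> < pi / 2" shows "\<bar>sin x\<bar> = sin \<bar>x\<bar>"
  using assms sin_ge_zero[of "\<bar>x\<bar>"] by (cases "0 \<le> x") (auto simp: abs_if split: if_splits)

lemma IVT_sign_change:
  fixes f :: "real \<Rightarrow> real"
  assumes "continuous_on {a..b} f" "a \<le> b" "f a * f b \<le> 0"
  shows "\<exists>x\<in>{a..b}. f x = 0"
proof -
  consider "f a \<le> 0 \<and> 0 \<le> f b" | "f b \<le> 0 \<and> 0 \<le> f a" using assms(3) by (auto simp: mult_le_0_iff)
  then show ?thesis
  proof cases
    case 1 then show ?thesis using IVT'[of f a 0 b] assms by auto
  next
    case 2 then show ?thesis using IVT2'[of f b 0 a] assms by auto
  qed
qed

text \<open>
  One point is chosen in each cell. A point can serve two cells only if it is their common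
  endpoint, and then its weight is two.
\<close>

lemma double_count_cells:
  fixes c :: "nat \<Rightarrow> real" and h :: real
  assumes h: "0 < h" and c: "\<And>j. j < n \<Longrightarrow> real j * h \<le> c j \<and> c j \<le> real (Suc j) * h"
    and w1: "\<And>s. (1::nat) \<le> w s"
    and w2: "\<And>j. 0 < j \<Longrightarrow> j < n \<Longrightarrow> real j * h \<in> c ` {..<n} \<Longrightarrow> 2 \<le> w (real j * h)"
  shows "n \<le> (\<Sum>s\<in>c ` {..<n}. w s)"
proof -
  have "card {j \<in> {..<n}. c j = s} \<le> w s" if s: "s \<in> c ` {..<n}" for s
  proof -
    define J where "J = {j \<in> {..<n}. c j = s}"
    have fin: "finite J" "J \<noteq> {}" using s by (auto simp: J_def)
    define j0 where "j0 = Min J"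
    have j0: "j0 \<in> J" using fin by (simp add: j0_def)
    have sub: "j = j0 \<or> j = Suc j0 \<and> s = real j * h" if "j \<in> J" for j
    proof -
      have le: "j0 \<le> j" using that fin by (simp add: j0_def)
      have "real j * h \<le> s" "s \<le> real (Suc j0) * h" using c[of j] c[of j0] that j0 by (auto simp: J_def)
      then have "j \<le> Suc j0"
        using h by (metis mult_le_cancel_right_pos of_nat_le_iff order_trans)
      then consider "j = j0" | "j = Suc j0" using le by linarith
      then show ?thesis
      proof cases
        case 2
        then have "s = real j * h"
          using \<open>real j * h \<le> s\<close> \<open>s \<le> real (Suc j0) * h\<close> by (intro antisym) simp_all
        then show ?thesis using 2 by blast
      qed blast
    qed
    show ?thesis
    proof (cases "J = {j0}")
      case True
      then show ?thesis using w1[of s] unfolding J_def[symmetric] by simp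
    next
      case False
      then obtain j where j: "j \<in> J" "j = Suc j0" "s = real j * h" using sub j0 by blast
      have "j < n" "0 < j" using j by (auto simp: J_def)
      then have "2 \<le> w s" using w2[of j] s unfolding j(3) by blast
      moreover have "J \<subseteq> {j0, Suc j0}" using sub by blast
      then have "card J \<le> card {j0, Suc j0}" by (intro card_mono) auto
      ultimately show ?thesis unfolding J_def[symmetric] by (simp add: card_insert_if)
    qed
  qed
  then have "(\<Sum>s\<in>c ` {..<n}. card {j \<in> {..<n}. c j = s}) \<le> (\<Sum>s\<in>c ` {..<n}. w s)" by (rule sum_mono)
  moreover have "(\<Sum>s\<in>c ` {..<n}. card {j \<in> {..<n}. c j = s}) = n"
    using sum.image_gen[of "{..<n}" "\<lambda>_. 1 :: nat" c] by simp
  ultimately show ?thesis by simp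
qed

text \<open>
  A function with the properties of \<open>s\<^sub>n\<close> that enter the count of coincidences.
\<close>

locale competitor = elliptic_modulus +
  fixes n :: nat and p q :: "complex poly"
  assumes n: "0 < n"
    and degree: "degree p \<le> n" "degree q \<le> n"
    and mirror: "mirror_symmetric p q"
    and q_nonzero: "cmod z = 1 \<Longrightarrow> poly q z \<noteq> 0"
    and unimodular: "cmod z = 1 \<Longrightarrow> cmod (poly p z / poly q z) = 1"
    and at_i: "poly p \<i> = \<i> * poly q \<i>"

begin

abbreviation F :: "real \<Rightarrow> complex" where "F v \<equiv> poly p (cis (\<omega> v)) / poly q (cis (\<omega> v))"

text \<open>
  The numerator of the difference of the competitor and \<open>s\<^sub>n\<close>.
\<close>

definition W :: "complex poly" where "W = p * Q n - P n * q"

lemma W_eq: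
  assumes "cmod z = 1"
  shows "poly p z / poly q z - poly (P n) z / poly (Q n) z = poly W z / (poly q z * poly (Q n) z)"
  using q_nonzero[OF assms] Q_nonzero[OF assms] by (simp add: W_def divide_simps)

lemma degree_W: "degree W \<le> 2 * n"
proof -
  have "degree (p * Q n) \<le> n + n" "degree (P n * q) \<le> n + n"
    using degree degree_PQ[of n] by (auto intro!: order_trans[OF degree_mult_le] add_mono)
  then show ?thesis unfolding W_def by (intro degree_diff_le) auto
qed

lemma W_mirror: "poly W (- cnj z) = - cnj (poly W z)"
  using mirror mirror_symmetric_zol[OF mirror_symmetric_id] by (simp add: W_def mirror_symmetric_def)

lemma W_at_i: "poly W \<i> = 0"
  using at_i zol_at_i by (simp add: W_def)

lemma W_root:
  assumes "F v = cis (phase n v)" shows "poly W (cis (\<omega> v)) = 0"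
  using W_eq[of "cis (\<omega> v)"] assms PQ_on_arc[of n v] q_nonzero[of "cis (\<omega> v)"] Q_nonzero[of "cis (\<omega> v)" n]
  by simp

lemma F_deriv: "\<exists>d. (F has_vector_derivative d) (at v)"
proof -
  have "((\<lambda>z. poly p z / poly q z) has_field_derivative
      (poly (pderiv p) (cis (\<omega> v)) * poly q (cis (\<omega> v)) - poly p (cis (\<omega> v)) * poly (pderiv q) (cis (\<omega> v)))
       / (poly q (cis (\<omega> v)) * poly q (cis (\<omega> v)))) (at (cis (\<omega> v)))"
    by (rule DERIV_divide[OF poly_DERIV poly_DERIV q_nonzero]) simp
  from field_vector_diff_chain_at[OF cis_\<omega>_deriv this] show ?thesis by (auto simp: o_def)
qed

lemma continuous_F: "continuous_on S F"
  using F_deriv by (meson continuous_at_imp_continuous_on has_vector_derivative_continuous)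

lemma W_double_root:
  assumes v: "0 < v" "v < 2 * K" and eq: "F v = cis (phase n v)"
    and d: "(F has_vector_derivative 0) (at v)" "((\<lambda>v. cis (phase n v)) has_vector_derivative 0) (at v)"
  shows "poly (pderiv W) (cis (\<omega> v)) = 0"
proof -
  let ?z = "cis (\<omega> v)"
  let ?E = "q * Q n"
  have E0: "poly ?E ?z \<noteq> 0" using q_nonzero[of ?z] Q_nonzero[of ?z n] by simp
  have "((\<lambda>z. poly W z / poly ?E z) has_field_derivative
      (poly (pderiv W) ?z * poly ?E ?z - poly W ?z * poly (pderiv ?E) ?z) / (poly ?E ?z * poly ?E ?z)) (at ?z)"
    by (rule DERIV_divide[OF poly_DERIV poly_DERIV E0])
  then have "((\<lambda>z. poly W z / poly ?E z) has_field_derivative poly (pderiv W) ?z / poly ?E ?z) (at ?z)"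
    by (rule DERIV_cong) (use W_root[OF eq] E0 in simp)
  from field_vector_diff_chain_at[OF cis_\<omega>_deriv this]
  have "((\<lambda>v. poly W (cis (\<omega> v)) / poly ?E (cis (\<omega> v))) has_vector_derivative
      of_real (- (k * kc * sn v / dn v)) * (\<i> * ?z) * (poly (pderiv W) ?z / poly ?E ?z)) (at v)"
    by (simp only: o_def)
  moreover have "poly W (cis (\<omega> v)) / poly ?E (cis (\<omega> v)) = F v - cis (phase n v)" for v
    using W_eq[of "cis (\<omega> v)"] PQ_on_arc[of n v] by simp
  ultimately have "((\<lambda>v. F v - cis (phase n v)) has_vector_derivative
      of_real (- (k * kc * sn v / dn v)) * (\<i> * ?z) * (poly (pderiv W) ?z / poly ?E ?z)) (at v)"
    by (simp only:)
  moreover have "((\<lambda>v. F v - cis (phase n v)) has_vector_derivative 0 - 0) (at v)"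
    by (rule has_vector_derivative_diff[OF d])
  ultimately have "of_real (- (k * kc * sn v / dn v)) * (\<i> * ?z) * (poly (pderiv W) ?z / poly ?E ?z) = 0 - 0"
    by (rule vector_derivative_unique_at)
  then show ?thesis
    using cis_\<omega>_speed_nonzero[OF v] E0 by (simp only: diff_self mult_eq_0_iff divide_eq_0_iff) auto
qed

lemma phase_abs_less: "0 \<le> v \<Longrightarrow> v \<le> 2 * K \<Longrightarrow> \<bar>phase n v\<bar> < pi / 2"
  using phase_bound[OF n, of v] phase_0_bound[OF n] by linarith

lemma sin_phase_bound: "0 \<le> v \<Longrightarrow> v \<le> 2 * K \<Longrightarrow> \<bar>sin (phase n v)\<bar> \<le> \<bar>sin (phase n 0)\<bar>"
proof -
  assume "0 \<le> v" "v \<le> 2 * K"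
  then have le: "\<bar>phase n v\<bar> \<le> \<bar>phase n 0\<bar>" using phase_bound[OF n] by simp
  have "sin \<bar>phase n v\<bar> \<le> sin \<bar>phase n 0\<bar>"
    using le phase_0_bound[OF n] by (intro sin_monotone_2pi_le) auto
  then show ?thesis using abs_sin_eq phase_0_bound[OF n] le by auto
qed

lemma coincideI:
  assumes "0 \<le> v" "v \<le> 2 * K" "0 < Re (F v)" "Im (F v) = sin (phase n v)"
  shows "F v = cis (phase n v)"
  using assms unimodular[of "cis (\<omega> v)"] phase_abs_less[of v] cos_gt_zero_pi[of "phase n v"]
  by (intro unimodular_eqI) (auto simp: abs_less_iff)

text \<open>
  The amplitude of \<open>s\<^sub>n\<close> is at least that of the competitor. So the difference of the imaginary parts
  changes sign, at least weakly, over each of the \<open>n\<close> cells. A zero at an interior endpoint of a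
  cell is double because both imaginary parts are extremal there.
\<close>

lemma dominated_competitor:
  assumes F: "\<And>v. 0 \<le> v \<Longrightarrow> v \<le> 2 * K \<Longrightarrow> 0 < Re (F v) \<and> \<bar>Im (F v)\<bar> \<le> \<bar>sin (phase n 0)\<bar>"
  shows "W = 0"
proof -
  define h where "h = 2 * K / n"
  have h: "0 < h" using K_pos n by (simp add: h_def)
  have nh: "real n * h = 2 * K" using n by (simp add: h_def)
  have hb: "0 \<le> real j * h" "j \<le> n \<Longrightarrow> real j * h \<le> 2 * K" for j
    using h mult_right_mono[of "real j" "real n" h] by (auto simp flip: nh)
  let ?D = "\<lambda>v. Im (F v) - sin (phase n v)"
  have "\<exists>c. real j * h \<le> c \<and> c \<le> real (Suc j) * h \<and> ?D c = 0" if j: "j < n" for j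
  proof -
    have s: "sin (phase n (real i * h)) = (-1) ^ i * sin (phase n 0)" for i
      using phase_node[OF n, of i] by (cases "even i") (auto simp: h_def)
    have "\<bar>Im (F (real i * h))\<bar> \<le> \<bar>sin (phase n 0)\<bar>" if "i \<le> n" for i
      using F hb that by blast
    from this[of j] this[of "Suc j"] j
    have "\<bar>Im (F (real j * h))\<bar> \<le> \<bar>sin (phase n 0)\<bar>" "\<bar>Im (F (real (Suc j) * h))\<bar> \<le> \<bar>sin (phase n 0)\<bar>"
      by auto
    then have "?D (real j * h) * ?D (real (Suc j) * h) \<le> 0"
      unfolding s by (cases "even j"; cases "0 \<le> sin (phase n 0)") (auto simp: mult_le_0_iff)
    moreover have "continuous_on {real j * h..real (Suc j) * h} ?D"
      by (intro continuous_intros continuous_F continuous_phase)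
    ultimately show ?thesis using IVT_sign_change[of "real j * h" "real (Suc j) * h" ?D] h by fastforce
  qed
  then obtain c where c: "\<And>j. j < n \<Longrightarrow> real j * h \<le> c j \<and> c j \<le> real (Suc j) * h \<and> ?D (c j) = 0"
    by metis
  have c01: "0 \<le> c j" "c j \<le> 2 * K" if "j < n" for j
    using c[OF that] hb(1)[of j] hb(2)[of "Suc j"] that by (auto intro: order_trans)
  have eq: "F (c j) = cis (phase n (c j))" if "j < n" for j
    using c[OF that] c01[OF that] F by (intro coincideI) auto
  define w where "w s = root_mult W (cis (\<omega> s))" for s
  have "n \<le> (\<Sum>s\<in>c ` {..<n}. w s)"
  proof (rule double_count_cells[OF h])
    show "real j * h \<le> c j \<and> c j \<le> real (Suc j) * h" if "j < n" for j using c[OF that] by simp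
    show "1 \<le> w s" for s by (simp add: w_def root_mult_def)
    show "2 \<le> w (real j * h)" if j: "0 < j" "j < n" "real j * h \<in> c ` {..<n}" for j
    proof -
      let ?v = "real j * h"
      have v: "0 < ?v" "?v < 2 * K"
        using h j mult_strict_right_mono[of "real j" "real n" h] by (auto simp flip: nh)
      have Fv: "F ?v = cis (phase n ?v)" using eq j by auto
      have "phase n ?v = (-1) ^ j * phase n 0" using phase_node[OF n, of j] by (simp only: h_def)
      then have sin: "\<bar>sin (phase n ?v)\<bar> = \<bar>sin (phase n 0)\<bar>" by (cases "even j") auto
      then have ext: "\<bar>Im (F ?v)\<bar> = \<bar>sin (phase n 0)\<bar>" unfolding Fv cis.sel .
      have near: "0 \<le> y \<and> y \<le> 2 * K" if "\<bar>?v - y\<bar> < min ?v (2 * K - ?v)" for y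
        using that by linarith
      have e: "0 < min ?v (2 * K - ?v)" using v by simp
      obtain d where d: "(F has_vector_derivative d) (at ?v)" using F_deriv by blast
      have "d = 0"
        using F near v unfolding ext[symmetric]
        by (intro unimodular_extremal_deriv[OF d _ _ e] unimodular) auto
      obtain d' where "(phase n has_real_derivative d') (at ?v)" using phase_deriv by blast
      from has_vector_derivative_cis[OF this]
      have d': "((\<lambda>v. cis (phase n v)) has_vector_derivative of_real d' * (\<i> * cis (phase n ?v))) (at ?v)" .
      have "of_real d' * (\<i> * cis (phase n ?v)) = 0"
      proof (rule unimodular_extremal_deriv[OF d' _ _ e])
        show "0 < Re (cis (phase n ?v))" using F[of ?v] v by (simp flip: Fv)
        show "\<bar>Im (cis (phase n y))\<bar> \<le> \<bar>Im (cis (phase n ?v))\<bar>" if "\<bar>?v - y\<bar> < min ?v (2 * K - ?v)" for y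
          using sin_phase_bound[of y] near[OF that] sin by simp
      qed simp
      then have "poly (pderiv W) (cis (\<omega> ?v)) = 0"
        using d d' \<open>d = 0\<close> by (intro W_double_root[OF v Fv]) auto
      then show ?thesis by (simp add: w_def root_mult_def)
    qed
  qed
  also have "\<dots> = (\<Sum>z\<in>(\<lambda>s. cis (\<omega> s)) ` c ` {..<n}. root_mult W z)"
  proof -
    have "c ` {..<n} \<subseteq> {0..2 * K}" using c01 by auto
    then have "inj_on (\<lambda>s. cis (\<omega> s)) (c ` {..<n})" by (rule inj_on_subset[OF inj_on_cis_\<omega>])
    then show ?thesis by (simp add: sum.reindex w_def)
  qed
  finally show ?thesis
    using eq W_root Re_cis_\<omega>
    by (intro mirror_roots_exceed_degree[OF degree_W W_mirror W_at_i]) auto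
qed

lemma crossing_competitor:
  assumes C: "C \<subseteq> {0..2 * K}" "finite C" "n \<le> card C"
    and F: "\<And>v. v \<in> C \<Longrightarrow> 0 < Re (F v) \<and> Im (F v) = sin (phase n v)"
  shows "W = 0"
proof (rule mirror_roots_exceed_degree[OF degree_W W_mirror W_at_i])
  let ?Z = "(\<lambda>v. cis (\<omega> v)) ` C"
  show "finite ?Z" using C by simp
  show "0 < Re z \<and> poly W z = 0" if "z \<in> ?Z" for z
  proof -
    obtain v where v: "v \<in> C" "z = cis (\<omega> v)" using \<open>z \<in> ?Z\<close> by blast
    then have "F v = cis (phase n v)" using F C(1) by (intro coincideI) auto
    then show ?thesis unfolding v(2) using W_root Re_cis_\<omega> by blast
  qed
  have "n \<le> card ?Z"
    using C(3) card_image[OF inj_on_subset[OF inj_on_cis_\<omega> C(1)]] by simp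
  also have "\<dots> = (\<Sum>z\<in>?Z. 1)" by simp
  also have "\<dots> \<le> (\<Sum>z\<in>?Z. root_mult W z)" by (intro sum_mono) (simp add: root_mult_def)
  finally show "n \<le> (\<Sum>z\<in>?Z. root_mult W z)" .
qed

end

section \<open>The composite\<close>

text \<open>
  The modulus \<open>k'\<close> belongs to \<open>\<Theta>' = \<bar>phase m 0\<bar>\<close>, so that the values of \<open>R = s\<^sub>m\<close> on the arc for \<open>\<Theta>\<close>
  fill exactly the arc on which \<open>R' = s\<^bsub>m'\<^esub>\<close> is described by its own phase.
\<close>

locale nested_moduli = first: elliptic_modulus k + second: elliptic_modulus k' for k k' +
  fixes m m' :: nat
  assumes m: "0 < m" and m': "0 < m'" and k': "k' = sin \<bar>first.phase m 0\<bar>"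
begin

abbreviation p :: "complex poly" where "p \<equiv> zol_num m' (second.\<alpha>\<^sub>z m') (second.\<gamma>\<^sub>z m') (first.P m) (first.Q m)"
abbreviation q :: "complex poly" where "q \<equiv> zol_den m' (second.\<alpha>\<^sub>z m') (second.\<gamma>\<^sub>z m') (first.P m) (first.Q m)"
abbreviation R :: "complex \<Rightarrow> complex" where "R z \<equiv> poly (first.P m) z / poly (first.Q m) z"
abbreviation R' :: "complex \<Rightarrow> complex" where "R' z \<equiv> poly (second.P m') z / poly (second.Q m') z"

lemma composite_value:
  assumes "poly (first.Q m) z \<noteq> 0"
  shows "poly p z / poly q z = R' (R z)"
  using assms by (simp add: poly_zol_num_homogeneous[OF assms] poly_zol_den_homogeneous[OF assms])

sublocale competitor k "m' * m" p q
proof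
  show "0 < m' * m" using m m' by simp
  show "degree p \<le> m' * m" "degree q \<le> m' * m"
    using first.degree_PQ by (auto intro: degree_zol_num degree_zol_den)
  show "mirror_symmetric p q"
    by (intro mirror_symmetric_zol mirror_symmetric_id)
  fix z :: complex assume z: "cmod z = 1"
  have Q: "poly (first.Q m) z \<noteq> 0" using z by (rule first.Q_nonzero)
  have R: "cmod (R z) = 1" using z by (rule first.cmod_PQ)
  show "poly q z \<noteq> 0"
    unfolding poly_zol_den_homogeneous[OF Q] using Q second.Q_nonzero[OF R, of m'] by simp
  show "cmod (poly p z / poly q z) = 1"
    unfolding composite_value[OF Q] by (rule second.cmod_PQ[OF R])
next
  have Q: "poly (first.Q m) \<i> \<noteq> 0" by (rule first.Q_nonzero) simp
  have "R \<i> = \<i>" using Q zol_at_i by simp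
  then show "poly p \<i> = \<i> * poly q \<i>"
    unfolding poly_zol_num_homogeneous[OF Q] poly_zol_den_homogeneous[OF Q] using zol_at_i by simp
qed

abbreviation \<Theta>' :: real where "\<Theta>' \<equiv> \<bar>first.phase m 0\<bar>"

lemma \<Theta>'_bounds: "0 < \<Theta>'" "\<Theta>' < pi / 2"
  using first.phase_0_nonzero[OF m] first.phase_0_bound[OF m] by auto

lemma second_\<omega>_ends: "second.\<omega> 0 = \<Theta>'" "second.\<omega> (2 * second.K) = - \<Theta>'"
proof -
  have "arcsin k' = \<Theta>'" unfolding k' using \<Theta>'_bounds by (intro arcsin_sin) auto
  moreover have "arcsin (- k') = - arcsin k'"
    using second.k_pos second.k_less_1 by (intro arcsin_minus) auto
  moreover have "second.cn (2 * second.K) = - 1" "second.dn (2 * second.K) = 1"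
    using second.jacobi_add_2K[of 0] by simp_all
  ultimately show "second.\<omega> 0 = \<Theta>'" "second.\<omega> (2 * second.K) = - \<Theta>'"
    by (simp_all add: second.\<omega>_def)
qed

lemma continuous_second_\<omega>: "continuous_on S second.\<omega>"
  using second.\<omega>_deriv by (meson DERIV_isCont continuous_at_imp_continuous_on)

text \<open>
  Here \<open>u\<close> is the elliptic coordinate, for the second modulus, of the value of \<open>s\<^sub>m\<close>.
\<close>

lemma F_eq:
  assumes "second.\<omega> u = first.phase m v"
  shows "F v = cis (second.phase m' u)"
proof -
  have "poly (first.Q m) (cis (first.\<omega> v)) \<noteq> 0" by (rule first.Q_nonzero) simp
  then have "F v = R' (R (cis (first.\<omega> v)))" by (rule composite_value)
  then show ?thesis unfolding first.PQ_on_arc assms[symmetric] second.PQ_on_arc .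
qed

lemma second_\<omega>_range:
  assumes "0 \<le> u" "u \<le> 2 * second.K" shows "- \<Theta>' \<le> second.\<omega> u \<and> second.\<omega> u \<le> \<Theta>'"
proof -
  have "second.\<omega> u \<le> \<Theta>'"
    using second.\<omega>_strict_antimono[of 0 u] assms second_\<omega>_ends(1) by (cases "u = 0") auto
  moreover have "- \<Theta>' \<le> second.\<omega> u"
    using second.\<omega>_strict_antimono[of u "2 * second.K"] assms second_\<omega>_ends(2)
    by (cases "u = 2 * second.K") auto
  ultimately show ?thesis by simp
qed

lemma F_bounds:
  assumes "0 \<le> v" "v \<le> 2 * first.K"
  shows "0 < Re (F v) \<and> \<bar>Im (F v)\<bar> \<le> sin \<bar>second.phase m' 0\<bar>"
proof -
  have "\<bar>first.phase m v\<bar> \<le> \<Theta>'" using first.phase_bound[OF m] assms by simp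
  then have "\<exists>u\<ge>0. u \<le> 2 * second.K \<and> second.\<omega> u = first.phase m v"
    using second.K_pos
    by (intro IVT2' continuous_second_\<omega>) (simp_all only: second_\<omega>_ends abs_le_iff, auto)
  then obtain u where u: "0 \<le> u" "u \<le> 2 * second.K" "second.\<omega> u = first.phase m v" by blast
  have le: "\<bar>second.phase m' u\<bar> \<le> \<bar>second.phase m' 0\<bar>" using second.phase_bound[OF m'] u by simp
  have lt: "\<bar>second.phase m' 0\<bar> < pi / 2" by (rule second.phase_0_bound[OF m'])
  have "0 < cos (second.phase m' u)" using le lt by (intro cos_gt_zero_pi) auto
  moreover have "sin (second.phase m' u) \<le> sin \<bar>second.phase m' 0\<bar>"
    using le lt by (intro sin_monotone_2pi_le) auto
  moreover have "sin (- second.phase m' u) \<le> sin \<bar>second.phase m' 0\<bar>"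
    using le lt by (intro sin_monotone_2pi_le) auto
  ultimately show ?thesis by (simp add: F_eq[OF u(3)] abs_le_iff)
qed

abbreviation h :: real where "h \<equiv> 2 * first.K / m"
abbreviation h' :: real where "h' \<equiv> 2 * second.K / m'"

text \<open>
  On the cell with index \<open>i\<close> the phase of \<open>s\<^sub>m\<close> sweeps out the whole of \<open>[- \<Theta>', \<Theta>']\<close> and in particular the
  image of the cell with index \<open>j\<close> for the second modulus. At its ends the composite takes opposite
  extreme values, between which it must cross \<open>s\<^bsub>m'm\<^esub>\<close>, whose amplitude is smaller.
\<close>

lemma crossing_in_cell:
  assumes i: "i < m" and j: "j < m'"
    and less: "sin \<bar>first.phase (m' * m) 0\<bar> < sin \<bar>second.phase m' 0\<bar>"
  shows "\<exists>v. real i * h < v \<and> v < real (Suc i) * h \<and>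
    second.\<omega> (real (Suc j) * h') < first.phase m v \<and> first.phase m v < second.\<omega> (real j * h') \<and>
    Im (F v) = sin (first.phase (m' * m) v)"
proof -
  define x y where "x = real i * h" and "y = real (Suc i) * h"
  have h0: "0 < h" using first.K_pos m by simp
  have h'0: "0 < h'" using second.K_pos m' by simp
  have xy: "x < y" "0 \<le> x" "y \<le> 2 * first.K"
  proof -
    show "x < y" unfolding x_def y_def using h0 by (intro mult_strict_right_mono) auto
    show "0 \<le> x" unfolding x_def using h0 by (intro mult_nonneg_nonneg) auto
    have "y \<le> real m * h" unfolding y_def using h0 i by (intro mult_right_mono) auto
    then show "y \<le> 2 * first.K" using m by simp
  qed
  have nb: "0 \<le> real t * h'" "real t * h' \<le> 2 * second.K" if "t \<le> m'" for t
  proof -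
    show "0 \<le> real t * h'" using h'0 by (intro mult_nonneg_nonneg) auto
    have "real t * h' \<le> real m' * h'" using h'0 that by (intro mult_right_mono) auto
    then show "real t * h' \<le> 2 * second.K" using m' by simp
  qed
  have \<omega>b: "- \<Theta>' \<le> second.\<omega> (real t * h') \<and> second.\<omega> (real t * h') \<le> \<Theta>'" if "t \<le> m'" for t
    using nb[OF that] by (intro second_\<omega>_range)
  have \<omega>less: "second.\<omega> (real (Suc j) * h') < second.\<omega> (real j * h')"
    using nb[of j] nb[of "Suc j"] j h'0 by (intro second.\<omega>_strict_antimono mult_strict_right_mono) auto
  have px: "first.phase m x = (-1) ^ i * first.phase m 0" unfolding x_def by (rule first.phase_node[OF m])
  have py: "first.phase m y = - ((-1) ^ i * first.phase m 0)" unfolding y_def first.phase_node[OF m] by simp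
  have "\<exists>v. x \<le> v \<and> v \<le> y \<and> first.phase m v = second.\<omega> (real t * h')" if "t \<le> m'" for t
  proof -
    have "(first.phase m x - second.\<omega> (real t * h')) * (first.phase m y - second.\<omega> (real t * h')) \<le> 0"
      using \<omega>b[OF that] unfolding px py by (cases "even i"; cases "0 \<le> first.phase m 0") (auto simp: mult_le_0_iff)
    moreover have "continuous_on {x..y} (\<lambda>v. first.phase m v - second.\<omega> (real t * h'))"
      by (intro continuous_intros first.continuous_phase)
    ultimately show ?thesis
      using IVT_sign_change[of x y "\<lambda>v. first.phase m v - second.\<omega> (real t * h')"] xy by fastforce
  qed
  from this[of j] this[of "Suc j"] j obtain v1 v2 where
    v1: "x \<le> v1" "v1 \<le> y" "first.phase m v1 = second.\<omega> (real j * h')" and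
    v2: "x \<le> v2" "v2 \<le> y" "first.phase m v2 = second.\<omega> (real (Suc j) * h')" by auto
  let ?s = "sin (second.phase m' 0)"
  have F1: "Im (F v1) = (-1) ^ j * ?s"
    using F_eq[OF v1(3)[symmetric]] by (cases "even j") (auto simp: second.phase_node[OF m'] simp del: times_divide_eq_right)
  have F2: "Im (F v2) = - ((-1) ^ j * ?s)"
    using F_eq[OF v2(3)[symmetric]] by (cases "even j") (auto simp: second.phase_node[OF m'] simp del: times_divide_eq_right of_nat_Suc)
  let ?G = "\<lambda>v. sin (first.phase (m' * m) v)"
  have G: "\<bar>?G v\<bar> < \<bar>?s\<bar>" if "x \<le> v" "v \<le> y" for v
    using sin_phase_bound[of v] that xy less abs_sin_eq[OF first.phase_0_bound[OF n]] abs_sin_eq[OF second.phase_0_bound[OF m']]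
    by linarith
  define a b where "a = min v1 v2" and "b = max v1 v2"
  have ab: "x \<le> a" "b \<le> y" "a \<le> b" using v1 v2 by (auto simp: a_def b_def)
  let ?D = "\<lambda>v. Im (F v) - ?G v"
  have "?D v1 * ?D v2 < 0"
    unfolding F1 F2 using G[OF v1(1,2)] G[OF v2(1,2)]
    by (cases "even j"; cases "0 \<le> ?s") (auto simp: mult_less_0_iff)
  then have prod: "?D a * ?D b < 0" by (cases "v1 \<le> v2") (auto simp: a_def b_def mult.commute)
  moreover have "continuous_on {a..b} ?D"
    by (intro continuous_intros continuous_F first.continuous_phase)
  ultimately obtain v where v: "a \<le> v" "v \<le> b" "?D v = 0"
    using IVT_sign_change[of a b ?D] ab by fastforce
  then have "v \<noteq> a" "v \<noteq> b" using prod by auto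
  then have strict: "a < v" "v < b" using v by auto
  have "first.phase m a < first.phase m v \<and> first.phase m v < first.phase m b \<or>
      first.phase m b < first.phase m v \<and> first.phase m v < first.phase m a"
    using ab by (intro first.phase_between_on_cell[OF m i _ strict]) (auto simp: x_def y_def)
  then have "second.\<omega> (real (Suc j) * h') < first.phase m v \<and> first.phase m v < second.\<omega> (real j * h')"
    using \<omega>less v1(3) v2(3) by (cases "v1 \<le> v2") (auto simp: a_def b_def)
  then show ?thesis using strict ab v(3) unfolding x_def y_def by (intro exI[of _ v]) auto
qed

text \<open>
  The comparison is made with \<open>s\<^bsub>m'm\<^esub>\<close> as the dominating function if its amplitude is the larger one,
  and with the composite otherwise. In the second case the crossings are indexed by pairs of cells
  and are distinct: the first index is read off from \<open>v\<close>, the second one from \<open>phase m v\<close>.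
\<close>

lemma composite_identity: "p * first.Q (m' * m) = first.P (m' * m) * q"
proof (cases "sin \<bar>second.phase m' 0\<bar> \<le> sin \<bar>first.phase (m' * m) 0\<bar>")
  case True
  have "sin \<bar>first.phase (m' * m) 0\<bar> \<le> \<bar>sin (first.phase (m' * m) 0)\<bar>"
    by (cases "0 \<le> first.phase (m' * m) 0") auto
  then have "W = 0" using F_bounds True by (intro dominated_competitor) force
  then show ?thesis by (simp add: W_def)
next
  case False
  then have "\<forall>ij\<in>{..<m} \<times> {..<m'}. \<exists>v. real (fst ij) * h < v \<and> v < real (Suc (fst ij)) * h \<and>
    second.\<omega> (real (Suc (snd ij)) * h') < first.phase m v \<and> first.phase m v < second.\<omega> (real (snd ij) * h') \<and>
    Im (F v) = sin (first.phase (m' * m) v)"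
    by (intro ballI crossing_in_cell) auto
  then obtain c where c: "\<And>ij. ij \<in> {..<m} \<times> {..<m'} \<Longrightarrow>
    real (fst ij) * h < c ij \<and> c ij < real (Suc (fst ij)) * h \<and>
    second.\<omega> (real (Suc (snd ij)) * h') < first.phase m (c ij) \<and> first.phase m (c ij) < second.\<omega> (real (snd ij) * h') \<and>
    Im (F (c ij)) = sin (first.phase (m' * m) (c ij))"
    by metis
  have h0: "0 < h" using first.K_pos m by simp
  have h'0: "0 < h'" using second.K_pos m' by simp
  have cb: "0 \<le> c ij \<and> c ij \<le> 2 * first.K" if "ij \<in> {..<m} \<times> {..<m'}" for ij
  proof -
    have "0 \<le> real (fst ij) * h" using h0 by (intro mult_nonneg_nonneg) auto
    moreover have "real (Suc (fst ij)) * h \<le> real m * h"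
      using h0 that by (intro mult_right_mono) auto
    ultimately show ?thesis using c[OF that] m by simp
  qed
  have inj: "inj_on c ({..<m} \<times> {..<m'})"
  proof (rule inj_onI)
    fix s t assume s: "s \<in> {..<m} \<times> {..<m'}" and t: "t \<in> {..<m} \<times> {..<m'}" and eq: "c s = c t"
    have "real (fst s) * h < real (Suc (fst t)) * h" "real (fst t) * h < real (Suc (fst s)) * h"
      using c[OF s] c[OF t] eq by linarith+
    then have "fst s < Suc (fst t)" "fst t < Suc (fst s)"
      using h0 by (simp_all only: mult_less_cancel_right_pos of_nat_less_iff)
    then have 1: "fst s = fst t" by simp
    have anti: "second.\<omega> (real b * h') \<le> second.\<omega> (real a * h')" if "a \<le> b" "b \<le> m'" for a b
    proof (cases "a = b")
      case False
      have "real b * h' \<le> real m' * h'" using h'0 that by (intro mult_right_mono) auto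
      then have "real b * h' \<le> 2 * second.K" using m' by simp
      moreover have "0 \<le> real a * h'" using h'0 by (intro mult_nonneg_nonneg) auto
      moreover have "real a * h' < real b * h'" using False that h'0 by (intro mult_strict_right_mono) auto
      ultimately have "second.\<omega> (real b * h') < second.\<omega> (real a * h')"
        by (intro second.\<omega>_strict_antimono)
      then show ?thesis by simp
    qed simp
    have 2: "\<not> snd s < snd t" using c[OF s] c[OF t] eq anti[of "Suc (snd s)" "snd t"] t by auto
    have 3: "\<not> snd t < snd s" using c[OF s] c[OF t] eq anti[of "Suc (snd t)" "snd s"] s by auto
    show "s = t" using 1 2 3 by (simp add: prod_eq_iff)
  qed
  have "W = 0"
  proof (rule crossing_competitor[of "c ` ({..<m} \<times> {..<m'})"])
    show "c ` ({..<m} \<times> {..<m'}) \<subseteq> {0..2 * first.K}" using cb by auto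
    show "m' * m \<le> card (c ` ({..<m} \<times> {..<m'}))" by (simp add: card_image[OF inj])
    show "0 < Re (F v) \<and> Im (F v) = sin (first.phase (m' * m) v)" if "v \<in> c ` ({..<m} \<times> {..<m'})" for v
      using that c cb F_bounds by auto
  qed simp
  then show ?thesis by (simp add: W_def)
qed

end

section \<open>Limits on the Riemann sphere\<close>

definition punctured :: "complex option \<Rightarrow> complex filter" where
  "punctured w = (case w of None \<Rightarrow> at_infinity | Some a \<Rightarrow> at a)"

lemma punctured_neq_bot [simp]: "punctured w \<noteq> bot"
  by (cases w) (auto simp: punctured_def trivial_limit_at_infinity)

lemma Hausdorff_riemann_sphere: "Hausdorff_space riemann_sphere"
  unfolding riemann_sphere_def Hausdorff_space_Alexandroff_compactification
  by (simp add: Hausdorff_space_euclidean locally_compact_space_euclidean)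

lemma sphere_lim_eqI:
  assumes "F \<noteq> bot" "limitin riemann_sphere f w F"
  shows "sphere_lim F f = w"
  unfolding sphere_lim_def
  using assms limitin_Hausdorff_unique[OF _ _ assms(1) Hausdorff_riemann_sphere]
  by (intro the_equality) auto

lemma limitin_sphere_Some:
  assumes "filterlim f (nhds a) F"
  shows "limitin riemann_sphere (\<lambda>x. Some (f x)) (Some a) F"
  unfolding limitin_def
proof (intro conjI allI impI)
  show "Some a \<in> topspace riemann_sphere" by (simp add: riemann_sphere_def)
  fix U assume U: "openin riemann_sphere U \<and> Some a \<in> U"
  obtain V where V: "open V" "a \<in> V" "Some ` V \<subseteq> U"
  proof -
    from U consider V where "open V" "U = Some ` V"
      | C where "closed C" "U = insert None (Some ` (- C))"
      by (auto simp: riemann_sphere_def openin_Alexandroff_compactification Compl_eq_Diff_UNIV)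
    then show thesis
    proof cases
      case 1 then show ?thesis using U that[of V] by auto
    next
      case 2 then show ?thesis using U that[of "- C"] by (auto simp: open_Compl)
    qed
  qed
  then have "eventually (\<lambda>x. f x \<in> V) F" using assms by (auto simp: topological_tendstoD)
  then show "eventually (\<lambda>x. Some (f x) \<in> U) F" by eventually_elim (use V in auto)
qed

lemma limitin_sphere_None:
  assumes "filterlim f at_infinity F"
  shows "limitin riemann_sphere (\<lambda>x. Some (f x)) None F"
  unfolding limitin_def
proof (intro conjI allI impI)
  show "None \<in> topspace riemann_sphere" by (simp add: riemann_sphere_def)
  fix U assume "openin riemann_sphere U \<and> None \<in> U"
  then obtain C where C: "compact C" "U = insert None (Some ` (- C))"
    by (auto simp: riemann_sphere_def openin_Alexandroff_compactification Compl_eq_Diff_UNIV)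
  then obtain b where b: "\<And>x. x \<in> C \<Longrightarrow> norm x \<le> b"
    using compact_imp_bounded bounded_iff by metis
  have "eventually (\<lambda>z. b + 1 \<le> norm z) at_infinity" by (auto simp: eventually_at_infinity)
  then have "eventually (\<lambda>x. b + 1 \<le> norm (f x)) F" using assms by (auto simp: filterlim_iff)
  then show "eventually (\<lambda>x. Some (f x) \<in> U) F"
  proof eventually_elim
    case (elim x)
    then have "f x \<notin> C" using b[of "f x"] by force
    then show ?case by (simp add: C(2))
  qed
qed

lemma filterlim_punctured_weaken:
  assumes "filterlim f (punctured w) F"
  shows "limitin riemann_sphere (\<lambda>x. Some (f x)) w F"
proof (cases w)
  case None
  then show ?thesis using assms limitin_sphere_None by (simp add: punctured_def)
next
  case (Some a)
  then have "filterlim f (nhds a) F" using assms by (simp add: punctured_def filterlim_at)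
  then show ?thesis using Some limitin_sphere_Some by simp
qed

lemma sphere_ext_eqI:
  assumes "filterlim f (punctured w') (punctured w)"
  shows "sphere_ext f w = w'"
  using sphere_lim_eqI[OF punctured_neq_bot filterlim_punctured_weaken[OF assms]]
  by (simp add: sphere_ext_def punctured_def)

text \<open>
  The limits are taken along punctured neighbourhoods on both sides; a limit along the full
  neighbourhood filter of the intermediate point would not compose with the second one.
\<close>

lemma sphere_ext_compose:
  assumes f: "filterlim f (punctured w') (punctured w)" and g: "filterlim g (punctured w'') (punctured w')"
    and h: "eventually (\<lambda>z. g (f z) = h z) (punctured w)"
  shows "sphere_ext g (sphere_ext f w) = sphere_ext h w"
proof -
  have "filterlim (\<lambda>z. g (f z)) (punctured w'') (punctured w)" by (rule filterlim_compose[OF g f])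
  then have "filterlim h (punctured w'') (punctured w)"
    using h by (simp add: filterlim_cong)
  then show ?thesis by (simp add: sphere_ext_eqI[OF f] sphere_ext_eqI[OF g] sphere_ext_eqI)
qed

lemma eventually_notin_finite_punctured:
  assumes "finite S" shows "eventually (\<lambda>z. z \<notin> S) (punctured w)"
proof -
  have "eventually (\<lambda>z. z \<noteq> s) (punctured w)" for s
  proof (cases w)
    case None
    have "eventually (\<lambda>z. cmod s + 1 \<le> norm z) at_infinity" by (auto simp: eventually_at_infinity)
    then have "eventually (\<lambda>z. z \<noteq> s) at_infinity" by eventually_elim auto
    then show ?thesis using None by (simp add: punctured_def)
  next
    case (Some a)
    have "eventually (\<lambda>z. z \<noteq> s) (at a)"
      by (cases "s = a") (auto simp: eventually_neq_at_within intro: eventually_at_filter[THEN iffD2] t1_space_nhds eventually_mono)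
    then show ?thesis using Some by (simp add: punctured_def)
  qed
  then have "eventually (\<lambda>z. \<forall>s\<in>S. z \<noteq> s) (punctured w)"
    using assms by (intro eventually_ball_finite) auto
  then show ?thesis by eventually_elim auto
qed

lemma eventually_poly_nonzero:
  "p \<noteq> 0 \<Longrightarrow> eventually (\<lambda>z. poly p z \<noteq> 0) (punctured w)"
  using eventually_notin_finite_punctured[OF poly_roots_finite[of p], of w] by simp

lemma rational_limit_at:
  fixes p q :: "complex poly"
  shows "(\<exists>c. filterlim (\<lambda>z. poly p z / poly q z) (nhds c) (at a)) \<or>
    filterlim (\<lambda>z. poly p z / poly q z) at_infinity (at a)"
proof -
  have an: "(\<lambda>z. poly r z) analytic_on {a}" for r :: "complex poly"
    unfolding analytic_at holomorphic_on_def field_differentiable_def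
    using poly_DERIV has_field_derivative_at_within by blast
  have "not_essential (\<lambda>z. poly p z / poly q z) a"
    by (intro not_essential_divide not_essential_analytic isolated_singularity_at_analytic an)
  then show ?thesis by (auto simp: not_essential_def is_pole_def)
qed

text \<open>
  The substitution \<open>z \<mapsto> 1 / z\<close> turns the quotient into another quotient of polynomials.
\<close>

lemma rational_limit_at_infinity:
  fixes p q :: "complex poly"
  shows "(\<exists>c. filterlim (\<lambda>z. poly p z / poly q z) (nhds c) at_infinity) \<or>
    filterlim (\<lambda>z. poly p z / poly q z) at_infinity at_infinity"
proof -
  define p' where "p' = reflect_poly p * monom 1 (degree q)"
  define q' where "q' = reflect_poly q * monom 1 (degree p)"
  have "poly p' (inverse z) / poly q' (inverse z) = poly p z / poly q z" if "z \<noteq> 0" for z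
    using that by (simp add: p'_def q'_def poly_monom poly_reflect_poly_nz)
  moreover have "eventually (\<lambda>z::complex. z \<noteq> 0) at_infinity"
    by (rule eventually_not_equal_at_infinity)
  ultimately have ev: "eventually (\<lambda>z. poly p' (inverse z) / poly q' (inverse z) = poly p z / poly q z) at_infinity"
    by (auto elim: eventually_mono)
  have inv: "filterlim inverse (at (0::complex)) at_infinity" by (simp add: filterlim_inverse_at_iff filterlim_ident)
  have "filterlim (\<lambda>z. poly p z / poly q z) F at_infinity"
    if "filterlim (\<lambda>z. poly p' z / poly q' z) F (at 0)" for F
  proof -
    have "filterlim (\<lambda>z. poly p' (inverse z) / poly q' (inverse z)) F at_infinity"
      by (rule filterlim_compose[OF that inv])
    then show ?thesis by (simp only: filterlim_cong[OF refl refl ev])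
  qed
  then show ?thesis using rational_limit_at[of p' q' 0] by blast
qed

text \<open>
  A finite limit \<open>c\<close> is attained only at zeros of \<open>p - c q\<close> or of \<open>q\<close>, and these are finite in number.
\<close>

lemma rational_filterlim_punctured:
  assumes q: "q \<noteq> 0" and nonconst: "\<And>c. p \<noteq> smult c q"
  shows "\<exists>w'. filterlim (\<lambda>z. poly p z / poly q z) (punctured w') (punctured w)"
proof -
  let ?f = "\<lambda>z. poly p z / poly q z"
  have "(\<exists>c. filterlim ?f (nhds c) (punctured w)) \<or> filterlim ?f at_infinity (punctured w)"
  proof (cases w)
    case None
    then show ?thesis using rational_limit_at_infinity[of p q] by (simp add: punctured_def)
  next
    case (Some a)
    then show ?thesis using rational_limit_at[of p q a] by (simp add: punctured_def)
  qed
  then show ?thesis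
  proof (elim disjE exE)
    fix c assume c: "filterlim ?f (nhds c) (punctured w)"
    have "p - smult c q \<noteq> 0" using nonconst by simp
    from eventually_poly_nonzero[OF this, of w] eventually_poly_nonzero[OF q, of w]
    have "eventually (\<lambda>z. ?f z \<noteq> c) (punctured w)"
      by eventually_elim (auto simp: field_simps)
    then have "filterlim ?f (punctured (Some c)) (punctured w)"
      using c by (simp add: punctured_def filterlim_at)
    then show ?thesis by blast
  next
    assume "filterlim ?f at_infinity (punctured w)"
    then have "filterlim ?f (punctured None) (punctured w)" by (simp add: punctured_def)
    then show ?thesis by blast
  qed
qed

context elliptic_modulus begin

lemma PQ_filterlim_punctured:
  assumes "0 < m"
  shows "\<exists>w'. filterlim (\<lambda>z. poly (P m) z / poly (Q m) z) (punctured w') (punctured w)"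
proof -
  obtain c where c: "poly (P m) c = 0" "poly (Q m) c \<noteq> 0" by (rule P_root_not_Q_root[OF assms])
  have "P m \<noteq> smult a (Q m)" for a
  proof
    assume eq: "P m = smult a (Q m)"
    then have "a = 0" using c by (metis mult_eq_0_iff poly_smult)
    then show False using eq P_nonzero[OF assms] by simp
  qed
  moreover have "Q m \<noteq> 0" using c by auto
  ultimately show ?thesis by (intro rational_filterlim_punctured)
qed

lemma \<omega>_0: "\<omega> 0 = arcsin k"
  by (simp add: \<omega>_def)

end

section \<open>The composition law\<close>

lemma elliptic_modulus_sin:
  assumes "0 < \<Theta>" "\<Theta> < pi / 2" shows "elliptic_modulus (sin \<Theta>)"
proof
  show "0 < sin \<Theta>" using assms by (intro sin_gt_zero) auto
  show "sin \<Theta> < 1" using sin_monotone_2pi[of \<Theta> "pi / 2"] assms by simp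
qed

lemma zol_formula_0: "zol_formula 0 \<Theta> z = \<i>"
  by (simp add: zol_formula_def)

lemma sphere_ext_zol_0: "sphere_ext (zol_formula 0 \<Theta>) w = Some \<i>"
proof -
  have "limitin riemann_sphere (\<lambda>z. Some (zol_formula 0 \<Theta> z)) (Some \<i>) (punctured w)"
    by (intro limitin_sphere_Some) (simp add: zol_formula_0)
  from sphere_lim_eqI[OF punctured_neq_bot this] show ?thesis
    by (simp add: sphere_ext_def punctured_def)
qed

text \<open>
  No coefficient is \<open>1\<close> or \<open>- 1\<close>, so the formula is continuous at its fixed point \<open>\<i>\<close>.
\<close>

lemma sphere_ext_zol_at_i:
  assumes "0 < t" "t < pi / 2"
  shows "sphere_ext (zol_formula m t) (Some \<i>) = Some \<i>"
proof -
  interpret elliptic_modulus "sin t" using assms by (rule elliptic_modulus_sin)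
  have eq: "zol_formula m t = (\<lambda>z. poly (P m) z / poly (Q m) z)"
    using zol_formula_eq[OF assms refl] by blast
  have "poly (Q m) \<i> \<noteq> 0" by (rule Q_nonzero) simp
  then have "isCont (zol_formula m t) \<i>" "zol_formula m t \<i> = \<i>"
    unfolding eq using zol_at_i by (auto intro!: continuous_intros)
  then have "filterlim (zol_formula m t) (nhds \<i>) (at \<i>)" by (simp add: isCont_def)
  from sphere_lim_eqI[OF _ limitin_sphere_Some[OF this]] show ?thesis
    by (simp add: sphere_ext_def)
qed

lemma zol_s_half_pi_at_i: "zol_s m (pi / 2) (Some \<i>) = Some \<i>"
proof -
  have "eventually (\<lambda>t. t \<in> {0<..<pi / 2}) (at_left (pi / 2 :: real))"
    by (rule eventually_at_leftI[of 0]) auto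
  then have "eventually (\<lambda>t. sphere_ext (zol_formula m t) (Some \<i>) = Some \<i>) (at_left (pi / 2))"
    by eventually_elim (simp add: sphere_ext_zol_at_i)
  then have "limitin riemann_sphere (\<lambda>t. sphere_ext (zol_formula m t) (Some \<i>)) (Some \<i>) (at_left (pi / 2))"
    by (auto simp: limitin_def riemann_sphere_def elim: eventually_mono)
  then show ?thesis
    by (simp add: zol_s_def sphere_lim_eqI)
qed

theorem theorem3p3:
  fixes \<Theta> \<Theta>' :: real and m m' :: nat and z :: "complex option"
  assumes "0 < \<Theta>" and "\<Theta> < pi / 2"
    and "\<Theta>' = \<bar>Arg (zol_formula m \<Theta> (cis \<Theta>))\<bar>"
  shows "zol_s m' \<Theta>' (zol_s m \<Theta> z) = zol_s (m' * m) \<Theta> z"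
proof (cases "m = 0")
  case True
  then have "\<Theta>' = pi / 2" using assms(3) by (simp add: zol_formula_0)
  moreover have "zol_s 0 \<Theta> z = Some \<i>"
    using assms(2) by (simp add: zol_s_def sphere_ext_zol_0)
  ultimately show ?thesis
    using True by (simp only: zol_s_half_pi_at_i mult_0_right)
next
  case False
  then have m: "0 < m" by simp
  interpret first: elliptic_modulus "sin \<Theta>" using assms(1,2) by (rule elliptic_modulus_sin)
  have "first.\<omega> 0 = \<Theta>" using assms(1,2) by (simp add: first.\<omega>_0 arcsin_sin)
  then have "zol_formula m \<Theta> (cis \<Theta>) = cis (first.phase m 0)"
    using first.PQ_on_arc[of m 0] by (simp add: first.zol_formula_eq[OF assms(1,2) refl])
  moreover have "Arg (cis (first.phase m 0)) = first.phase m 0"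
    using first.phase_0_bound[OF m] by (intro Arg_cis) auto
  ultimately have \<Theta>': "\<Theta>' = \<bar>first.phase m 0\<bar>" using assms(3) by simp
  then have b: "0 < \<Theta>'" "\<Theta>' < pi / 2"
    using first.phase_0_nonzero[OF m] first.phase_0_bound[OF m] by auto
  show ?thesis
  proof (cases "m' = 0")
    case True
    then show ?thesis using assms(2) b by (simp add: zol_s_def sphere_ext_zol_0)
  next
    case False
    interpret second: elliptic_modulus "sin \<Theta>'" using b by (rule elliptic_modulus_sin)
    interpret nested_moduli "sin \<Theta>" "sin \<Theta>'" m m'
      using m False by unfold_locales (auto simp: \<Theta>')
    obtain w' where f: "filterlim R (punctured w') (punctured z)"
      using first.PQ_filterlim_punctured[OF m] by blast
    obtain w'' where g: "filterlim R' (punctured w'') (punctured w')"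
      using second.PQ_filterlim_punctured[OF m'] by blast
    have "r \<noteq> 0" if "poly r 1 \<noteq> 0" for r :: "complex poly" using that by auto
    then have "first.Q m \<noteq> 0" "first.Q (m' * m) \<noteq> 0" "q \<noteq> 0"
      using first.Q_nonzero[of 1] q_nonzero[of 1] by simp_all
    then have "eventually (\<lambda>z. poly (first.Q m) z \<noteq> 0) (punctured z)"
      "eventually (\<lambda>z. poly (first.Q (m' * m)) z \<noteq> 0) (punctured z)"
      "eventually (\<lambda>z. poly q z \<noteq> 0) (punctured z)"
      by (auto intro: eventually_poly_nonzero)
    then have "eventually (\<lambda>z. R' (R z) = poly (first.P (m' * m)) z / poly (first.Q (m' * m)) z) (punctured z)"
    proof eventually_elim
      case (elim z)
      have "poly p z * poly (first.Q (m' * m)) z = poly (first.P (m' * m)) z * poly q z"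
        using arg_cong[OF composite_identity, of "\<lambda>r. poly r z"] by simp
      then show ?case using elim by (simp add: composite_value[symmetric] frac_eq_eq)
    qed
    from sphere_ext_compose[OF f g this] show ?thesis
      using assms(2) b unfolding zol_s_def
      by (simp add: first.zol_formula_eq[OF assms(1,2) refl, abs_def] second.zol_formula_eq[OF b refl, abs_def])
  qed
qed

end
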